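(* (Horseshoe lemma) Let $0\to A'\xrightarrow{i_A}A\xrightarrow{\pi_A}A''\to0$ be a short exact sequence in $\mathrm{DVect}$, and let $$\cdots\to P_1'\xrightarrow{d_1'}P_0'\xrightarrow{\epsilon'}A'\to0\quad\text{and}\quad\cdots\to P_1''\xrightarrow{d_1''}P_0''\xrightarrow{\epsilon''}A''\to0$$ be diffeological projective resolutions of $A'$ and $A''$. Then there exist a diffeological projective resolution $$\cdots\to P_1'\oplus P_1''\xrightarrow{d_1}P_0'\oplus P_0''\xrightarrow{\epsilon}A\to0$$ of $A$ (with $n$-th term $P_n'\oplus P_n''$) and short exact sequences $0\to P_n'\xrightarrow{i_n}P_n'\oplus P_n''\xrightarrow{\pi_n}P_n''\to0$ in $\mathrm{DVect}$ for all $n\ge0$, such that the whole diagram commutes: $\epsilon\circ i_0=i_A\circ\epsilon'$, $\pi_A\circ\epsilon=\epsilon''\circ\pi_0$, and $d_n\circ i_n=i_{n-1}\circ d_n'$, $\pi_{n-1}\circ d_n=d_n''\circ\pi_n$ for all $n\ge1$.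
   Context: A diffeological space is a set $X$ together with a specified set of functions $U\to X$ (called plots), for every open set $U\subseteq\mathbb{R}^n$ and every $n\in\mathbb{N}=\{0,1,2,\dots\}$, such that: (1) every constant map $U\to X$ is a plot; (2) if $U\to X$ is a plot and $V\to U$ is a smooth map between open subsets of Euclidean spaces, then $V\to U\to X$ is a plot; (3) if $U=\bigcup_i U_i$ is an open cover and $U\to X$ is a map whose restrictions to all $U_i$ are plots, then $U\to X$ is a plot. A map between diffeological spaces is smooth if composing with it sends plots to plots. Products carry the product diffeology (a map into a product is a plot iff all its components are plots); subsets carry the sub-diffeology (plots are the plots of the ambient space with image in the subset); quotients carry the quotient diffeology (plots are the maps that locally lift to plots). $\mathbb{R}$ carries the standard diffeology. A diffeological vector space is a real vector space $V$ with a diffeology such that addition $V\times V\to V$ and scalar multiplication $\mathbb{R}\times V\to V$ are smooth. $\mathrm{DVect}$ is the category of diffeological vector spaces and smooth linear maps. The finite direct sum $\oplus$ in $\mathrm{DVect}$ is the product with the product diffeology. A map $f:X\to Y$ of diffeological spaces is an induction if it is injective and a map $q:U\to X$ is a plot iff $f\circ q$ is a plot of $Y$. It is a subduction if it is smooth, surjective, and every plot of $Y$ locally (near each point of its domain) lifts along $f$ to a plot of $X$. A sequence $0\to A\xrightarrow{i}E\xrightarrow{p}B\to0$ of smooth linear maps of diffeological vector spaces is a short exact sequence in $\mathrm{DVect}$ if it is a short exact sequence of vector spaces, $i$ is an induction and $p$ is a subduction. A diffeological vector space $V$ is projective if for every smooth linear subduction $f:W_1\to W_2$ of diffeological vector spaces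 and every smooth linear map $g:V\to W_2$ there exists a smooth linear map $h:V\to W_1$ with $g=f\circ h$. A diffeological chain complex $\mathbf{V}$ is a $\mathbb{Z}$-indexed sequence of diffeological vector spaces with smooth linear maps $d_n:V_n\to V_{n-1}$, $d_n\circ d_{n+1}=0$. It is exact at the $n$-th spot if the induced sequence $0\to V_{n+1}/\ker(d_{n+1})\to V_n\to\operatorname{Im}(d_n)\to0$ is a short exact sequence in $\mathrm{DVect}$, where $V_{n+1}/\ker(d_{n+1})$ has the quotient diffeology of $V_{n+1}$ and $\operatorname{Im}(d_n)$ the sub-diffeology of $V_{n-1}$; it is exact if it is exact at every spot. A diffeological projective resolution of a diffeological vector space $V$ is an exact diffeological chain complex $\mathbf{V}$ with $V_{-1}=V$, $V_n=0$ for $n<-1$, and $V_n$ projective for all $n\ge0$. *)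

theory Defs
  imports
    "HOL-Analysis.Abstract_Euclidean_Space"
    "HOL-Algebra.Module"
    "HOL-Algebra.AbelCoset"
begin

section \<open>Smooth maps between open subsets of Euclidean spaces\<close>

text \<open>
  The dimension of the domain of a plot varies inside a single diffeology, so \<open>\<real>\<^sup>n\<close> is taken to be
  \<^term>\<open>Euclidean_space n\<close>, whose points are the sequences vanishing from index \<open>n\<close> on.
\<close>

primrec C_k_on :: "nat \<Rightarrow> nat \<Rightarrow> (nat \<Rightarrow> real) set \<Rightarrow> ((nat \<Rightarrow> real) \<Rightarrow> real) \<Rightarrow> bool" where
  "C_k_on 0 n U f \<longleftrightarrow> continuous_map (subtopology (Euclidean_space n) U) euclideanreal f"
| "C_k_on (Suc k) n U f \<longleftrightarrow>
     continuous_map (subtopology (Euclidean_space n) U) euclideanreal f \<and>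
     (\<forall>i<n. \<exists>g. (\<forall>x\<in>U. ((\<lambda>t. f (x(i := t))) has_real_derivative g x) (at (x i))) \<and> C_k_on k n U g)"

definition smooth_fun :: "nat \<Rightarrow> (nat \<Rightarrow> real) set \<Rightarrow> ((nat \<Rightarrow> real) \<Rightarrow> real) \<Rightarrow> bool" where
  "smooth_fun n U f \<longleftrightarrow> openin (Euclidean_space n) U \<and> (\<forall>k. C_k_on k n U f)"

definition smooth_between ::
    "nat \<Rightarrow> (nat \<Rightarrow> real) set \<Rightarrow> nat \<Rightarrow> (nat \<Rightarrow> real) set \<Rightarrow> ((nat \<Rightarrow> real) \<Rightarrow> nat \<Rightarrow> real) \<Rightarrow> bool" where
  "smooth_between m V n U h \<longleftrightarrow>
     openin (Euclidean_space m) V \<and> openin (Euclidean_space n) U \<and> h \<in> V \<rightarrow> U \<and>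
     (\<forall>j<n. smooth_fun m V (\<lambda>x. h x j))"


section \<open>Diffeological spaces\<close>

text \<open>
  \<open>D n U p\<close> says that \<open>U\<close> is an open subset of \<open>\<real>\<^sup>n\<close> and that the restriction of \<open>p\<close> to \<open>U\<close> is a
  plot. HOL functions are total, so a diffeology has to be insensitive to the values of \<open>p\<close>
  outside \<open>U\<close>; this is the second clause of \<open>diffeological_space\<close>.
\<close>

type_synonym 'a diffeology = "nat \<Rightarrow> (nat \<Rightarrow> real) set \<Rightarrow> ((nat \<Rightarrow> real) \<Rightarrow> 'a) \<Rightarrow> bool"

definition diffeological_space :: "'a set \<Rightarrow> 'a diffeology \<Rightarrow> bool" where
  "diffeological_space X D \<longleftrightarrow>
     (\<forall>n U p. D n U p \<longrightarrow> openin (Euclidean_space n) U \<and> p \<in> U \<rightarrow> X) \<and>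
     (\<forall>n U p q. D n U p \<longrightarrow> (\<forall>u\<in>U. q u = p u) \<longrightarrow> D n U q) \<and>
     (\<forall>n U x. openin (Euclidean_space n) U \<longrightarrow> x \<in> X \<longrightarrow> D n U (\<lambda>u. x)) \<and>
     (\<forall>n U p m V h. D n U p \<longrightarrow> smooth_between m V n U h \<longrightarrow> D m V (p \<circ> h)) \<and>
     (\<forall>n \<U> p. (\<forall>U\<in>\<U>. openin (Euclidean_space n) U) \<longrightarrow> p \<in> \<Union>\<U> \<rightarrow> X \<longrightarrow>
        (\<forall>U\<in>\<U>. D n U p) \<longrightarrow> D n (\<Union>\<U>) p)"

definition smooth_map :: "'a set \<Rightarrow> 'a diffeology \<Rightarrow> 'b set \<Rightarrow> 'b diffeology \<Rightarrow> ('a \<Rightarrow> 'b) \<Rightarrow> bool" where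
  "smooth_map X DX Y DY f \<longleftrightarrow> f \<in> X \<rightarrow> Y \<and> (\<forall>n U p. DX n U p \<longrightarrow> DY n U (f \<circ> p))"

definition induction_map :: "'a set \<Rightarrow> 'a diffeology \<Rightarrow> 'b set \<Rightarrow> 'b diffeology \<Rightarrow> ('a \<Rightarrow> 'b) \<Rightarrow> bool" where
  "induction_map X DX Y DY f \<longleftrightarrow> f \<in> X \<rightarrow> Y \<and> inj_on f X \<and>
     (\<forall>n U q. openin (Euclidean_space n) U \<longrightarrow> q \<in> U \<rightarrow> X \<longrightarrow> (DX n U q \<longleftrightarrow> DY n U (f \<circ> q)))"

text \<open>\<open>locally_lifts f DX n U q\<close>: near each point of \<open>U\<close>, \<open>q\<close> is \<open>f\<close> composed with a plot of \<open>DX\<close>.\<close>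

definition locally_lifts ::
    "('a \<Rightarrow> 'b) \<Rightarrow> 'a diffeology \<Rightarrow> nat \<Rightarrow> (nat \<Rightarrow> real) set \<Rightarrow> ((nat \<Rightarrow> real) \<Rightarrow> 'b) \<Rightarrow> bool" where
  "locally_lifts f DX n U q \<longleftrightarrow>
     (\<forall>u\<in>U. \<exists>V p. openin (Euclidean_space n) V \<and> u \<in> V \<and> V \<subseteq> U \<and> DX n V p \<and> (\<forall>v\<in>V. q v = f (p v)))"

definition subduction_map :: "'a set \<Rightarrow> 'a diffeology \<Rightarrow> 'b set \<Rightarrow> 'b diffeology \<Rightarrow> ('a \<Rightarrow> 'b) \<Rightarrow> bool" where
  "subduction_map X DX Y DY f \<longleftrightarrow> smooth_map X DX Y DY f \<and> f ` X = Y \<and>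
     (\<forall>n U q. DY n U q \<longrightarrow> locally_lifts f DX n U q)"

definition real_diffeology :: "real diffeology" where
  "real_diffeology n U p \<longleftrightarrow> smooth_fun n U p"

definition prod_diffeology :: "'a diffeology \<Rightarrow> 'b diffeology \<Rightarrow> ('a \<times> 'b) diffeology" where
  "prod_diffeology D1 D2 n U p \<longleftrightarrow> D1 n U (fst \<circ> p) \<and> D2 n U (snd \<circ> p)"

definition sub_diffeology :: "'a set \<Rightarrow> 'a diffeology \<Rightarrow> 'a diffeology" where
  "sub_diffeology S D n U p \<longleftrightarrow> D n U p \<and> p \<in> U \<rightarrow> S"

definition quotient_diffeology :: "('a \<Rightarrow> 'b) \<Rightarrow> 'a diffeology \<Rightarrow> 'b diffeology" where
  "quotient_diffeology f D n U q \<longleftrightarrow> openin (Euclidean_space n) U \<and> locally_lifts f D n U q"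


section \<open>Diffeological vector spaces\<close>

text \<open>
  The multiplicative fields \<open>mult\<close> and \<open>one\<close> inherited from \<open>ring\<close> play no role for modules.
\<close>

record 'a dvs = "(real, 'a) module" + plots :: "'a diffeology"

definition real_ring :: "real ring" where
  "real_ring = \<lparr>carrier = UNIV, mult = (*), one = 1, zero = 0, add = (+)\<rparr>"

definition is_dvs :: "'a dvs \<Rightarrow> bool" where
  "is_dvs V \<longleftrightarrow> module real_ring V \<and> diffeological_space (carrier V) (plots V) \<and>
     smooth_map (carrier V \<times> carrier V) (prod_diffeology (plots V) (plots V)) (carrier V) (plots V)
       (\<lambda>(x, y). x \<oplus>\<^bsub>V\<^esub> y) \<and>
     smooth_map (UNIV \<times> carrier V) (prod_diffeology real_diffeology (plots V)) (carrier V) (plots V)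
       (\<lambda>(a, x). a \<odot>\<^bsub>V\<^esub> x)"

definition dvs_hom :: "'a dvs \<Rightarrow> 'b dvs \<Rightarrow> ('a \<Rightarrow> 'b) set" where
  "dvs_hom V W = {f. smooth_map (carrier V) (plots V) (carrier W) (plots W) f \<and>
     (\<forall>x\<in>carrier V. \<forall>y\<in>carrier V. f (x \<oplus>\<^bsub>V\<^esub> y) = f x \<oplus>\<^bsub>W\<^esub> f y) \<and>
     (\<forall>a. \<forall>x\<in>carrier V. f (a \<odot>\<^bsub>V\<^esub> x) = a \<odot>\<^bsub>W\<^esub> f x)}"

abbreviation induction :: "'a dvs \<Rightarrow> 'b dvs \<Rightarrow> ('a \<Rightarrow> 'b) \<Rightarrow> bool" where
  "induction V W \<equiv> induction_map (carrier V) (plots V) (carrier W) (plots W)"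

abbreviation subduction :: "'a dvs \<Rightarrow> 'b dvs \<Rightarrow> ('a \<Rightarrow> 'b) \<Rightarrow> bool" where
  "subduction V W \<equiv> subduction_map (carrier V) (plots V) (carrier W) (plots W)"

definition zero_dvs :: "unit dvs" where
  "zero_dvs = \<lparr>carrier = UNIV, mult = (\<lambda>_ _. ()), one = (), zero = (), add = (\<lambda>_ _. ()),
     smult = (\<lambda>_ _. ()), plots = (\<lambda>n U p. openin (Euclidean_space n) U)\<rparr>"

definition direct_sum :: "'a dvs \<Rightarrow> 'b dvs \<Rightarrow> ('a \<times> 'b) dvs" (infixr \<open>\<oplus>\<^sub>D\<close> 65) where
  "V \<oplus>\<^sub>D W = \<lparr>carrier = carrier V \<times> carrier W, mult = undefined, one = undefined,
     zero = (\<zero>\<^bsub>V\<^esub>, \<zero>\<^bsub>W\<^esub>),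
     add = (\<lambda>x y. (fst x \<oplus>\<^bsub>V\<^esub> fst y, snd x \<oplus>\<^bsub>W\<^esub> snd y)),
     smult = (\<lambda>a x. (a \<odot>\<^bsub>V\<^esub> fst x, a \<odot>\<^bsub>W\<^esub> snd x)),
     plots = prod_diffeology (plots V) (plots W)\<rparr>"

definition sub_dvs :: "'a dvs \<Rightarrow> 'a set \<Rightarrow> 'a dvs" where
  "sub_dvs V S = V\<lparr>carrier := S, plots := sub_diffeology S (plots V)\<rparr>"

text \<open>
  The scalar multiple of a coset \<open>C = x + K\<close> is \<open>K + a \<cdot> C = a \<cdot> x + K\<close>; adding \<open>K\<close> is needed
  only for \<open>a = 0\<close>.
\<close>

definition quotient_dvs :: "'a dvs \<Rightarrow> 'a set \<Rightarrow> 'a set dvs" where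
  "quotient_dvs V K = \<lparr>carrier = a_rcosets\<^bsub>V\<^esub> K, mult = undefined, one = undefined,
     zero = K, add = (\<lambda>C D. C <+>\<^bsub>V\<^esub> D),
     smult = (\<lambda>a C. K <+>\<^bsub>V\<^esub> ((\<lambda>x. a \<odot>\<^bsub>V\<^esub> x) ` C)),
     plots = quotient_diffeology (\<lambda>x. K +>\<^bsub>V\<^esub> x) (plots V)\<rparr>"

definition short_exact ::
    "'a dvs \<Rightarrow> ('a \<Rightarrow> 'b) \<Rightarrow> 'b dvs \<Rightarrow> ('b \<Rightarrow> 'c) \<Rightarrow> 'c dvs \<Rightarrow> bool" where
  "short_exact A i E p B \<longleftrightarrow> is_dvs A \<and> is_dvs E \<and> is_dvs B \<and> i \<in> dvs_hom A E \<and> p \<in> dvs_hom E B \<and>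
     inj_on i (carrier A) \<and> i ` carrier A = a_kernel E B p \<and> p ` carrier E = carrier B \<and>
     induction A E i \<and> subduction E B p"


section \<open>Projective diffeological vector spaces\<close>

text \<open>
  HOL cannot quantify over types inside a definition, so the test spaces \<open>W1\<close>, \<open>W2\<close> are taken with
  carriers in one type, which depends on the type of \<open>V\<close>: formal linear combinations (as lists) of
  pairs of a plot of \<open>V\<close> and a point. This type is large enough for the lifting property to hold
  against diffeological vector spaces over all types; see \<open>projective_lift\<close> below.
\<close>

type_synonym 'a test =
  "(real \<times> (nat \<times> (nat \<Rightarrow> real) set \<times> ((nat \<Rightarrow> real) \<Rightarrow> 'a)) \<times> (nat \<Rightarrow> real)) list"

definition projective :: "'a dvs \<Rightarrow> bool" where
  "projective V \<longleftrightarrow> is_dvs V \<and>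
     (\<forall>(W1 :: 'a test dvs) (W2 :: 'a test dvs) f g.
        is_dvs W1 \<longrightarrow> is_dvs W2 \<longrightarrow> f \<in> dvs_hom W1 W2 \<longrightarrow> subduction W1 W2 f \<longrightarrow>
        g \<in> dvs_hom V W2 \<longrightarrow> (\<exists>h\<in>dvs_hom V W1. \<forall>x\<in>carrier V. g x = f (h x)))"


section \<open>Complexes, exactness and projective resolutions\<close>

text \<open>
  Exactness at the middle term of \<open>X \<longrightarrow> Y \<longrightarrow> Z\<close>. The map \<open>X / ker d \<longrightarrow> Y\<close> induced by \<open>d\<close> sends a
  coset \<open>C\<close> to the only element of \<open>d ` C\<close>.
\<close>

definition exact_at :: "'a dvs \<Rightarrow> ('a \<Rightarrow> 'b) \<Rightarrow> 'b dvs \<Rightarrow> ('b \<Rightarrow> 'c) \<Rightarrow> 'c dvs \<Rightarrow> bool" where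
  "exact_at X d Y e Z \<longleftrightarrow>
     short_exact (quotient_dvs X (a_kernel X Y d)) (\<lambda>C. the_elem (d ` C)) Y e (sub_dvs Z (e ` carrier Y))"

definition dvs_complex :: "(int \<Rightarrow> 'a dvs) \<Rightarrow> (int \<Rightarrow> 'a \<Rightarrow> 'a) \<Rightarrow> bool" where
  "dvs_complex V d \<longleftrightarrow> (\<forall>n. is_dvs (V n)) \<and> (\<forall>n. d n \<in> dvs_hom (V n) (V (n - 1))) \<and>
     (\<forall>n. \<forall>x\<in>carrier (V (n + 1)). d n (d (n + 1) x) = \<zero>\<^bsub>V (n - 1)\<^esub>)"

definition exact_complex :: "(int \<Rightarrow> 'a dvs) \<Rightarrow> (int \<Rightarrow> 'a \<Rightarrow> 'a) \<Rightarrow> bool" where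
  "exact_complex V d \<longleftrightarrow> dvs_complex V d \<and>
     (\<forall>n. exact_at (V (n + 1)) (d (n + 1)) (V n) (d n) (V (n - 1)))"

definition projective_resolution_complex :: "(int \<Rightarrow> 'a dvs) \<Rightarrow> (int \<Rightarrow> 'a \<Rightarrow> 'a) \<Rightarrow> 'a dvs \<Rightarrow> bool" where
  "projective_resolution_complex V d A \<longleftrightarrow> exact_complex V d \<and> V (- 1) = A \<and>
     (\<forall>n. n < - 1 \<longrightarrow> carrier (V n) = {\<zero>\<^bsub>V n\<^esub>}) \<and> (\<forall>n\<ge>0. projective (V n))"

text \<open>
  The same notion in the augmented form \<open>\<cdots> \<longrightarrow> P 1 \<longrightarrow> P 0 \<longrightarrow> A \<longrightarrow> 0\<close> with augmentation \<open>\<epsilon>\<close>, which lets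
  \<open>A\<close> and the \<open>P n\<close> have elements of different types: the terms in degrees below \<open>- 1\<close> vanish, so
  only exactness at \<open>A\<close>, at \<open>P 0\<close> and at the \<open>P (Suc n)\<close> has to be listed. The agreement with
  \<open>projective_resolution_complex\<close> is \<open>projective_resolution_complex_iff\<close> below. The map \<open>d (Suc n)\<close>
  goes from \<open>P (Suc n)\<close> to \<open>P n\<close>, and \<open>d 0\<close> is not used.
\<close>

definition projective_resolution ::
    "(nat \<Rightarrow> 'p dvs) \<Rightarrow> (nat \<Rightarrow> 'p \<Rightarrow> 'p) \<Rightarrow> ('p \<Rightarrow> 'a) \<Rightarrow> 'a dvs \<Rightarrow> bool" where
  "projective_resolution P d \<epsilon> A \<longleftrightarrow>
     is_dvs A \<and> (\<forall>n. projective (P n)) \<and>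
     \<epsilon> \<in> dvs_hom (P 0) A \<and> (\<forall>n. d (Suc n) \<in> dvs_hom (P (Suc n)) (P n)) \<and>
     (\<forall>x\<in>carrier (P 1). \<epsilon> (d 1 x) = \<zero>\<^bsub>A\<^esub>) \<and>
     (\<forall>n. \<forall>x\<in>carrier (P (Suc (Suc n))). d (Suc n) (d (Suc (Suc n)) x) = \<zero>\<^bsub>P n\<^esub>) \<and>
     exact_at (P 0) \<epsilon> A (\<lambda>_. ()) zero_dvs \<and>
     exact_at (P 1) (d 1) (P 0) \<epsilon> A \<and>
     (\<forall>n. exact_at (P (Suc (Suc n))) (d (Suc (Suc n))) (P (Suc n)) (d (Suc n)) (P n))"


section \<open>Elementary properties\<close>

context
  fixes X :: "'a set" and D :: "'a diffeology"
  assumes D: "diffeological_space X D"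
begin

lemmas diffeo_axioms = D[unfolded diffeological_space_def]

lemma diffeo_open: "D n U p \<Longrightarrow> openin (Euclidean_space n) U"
  using diffeo_axioms[THEN conjunct1] by blast

lemma diffeo_in: "D n U p \<Longrightarrow> u \<in> U \<Longrightarrow> p u \<in> X"
  using diffeo_axioms[THEN conjunct1] by blast

lemma diffeo_cong: "D n U p \<Longrightarrow> (\<And>u. u \<in> U \<Longrightarrow> q u = p u) \<Longrightarrow> D n U q"
  using diffeo_axioms[THEN conjunct2, THEN conjunct1] by simp

lemma diffeo_const: "openin (Euclidean_space n) U \<Longrightarrow> x \<in> X \<Longrightarrow> D n U (\<lambda>u. x)"
  using diffeo_axioms[THEN conjunct2, THEN conjunct2, THEN conjunct1] by simp

lemma diffeo_comp: "D n U p \<Longrightarrow> smooth_between m V n U h \<Longrightarrow> D m V (p \<circ> h)"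
  using diffeo_axioms[THEN conjunct2, THEN conjunct2, THEN conjunct2, THEN conjunct1] by simp

lemma diffeo_cover:
  "(\<And>U. U \<in> \<U> \<Longrightarrow> openin (Euclidean_space n) U) \<Longrightarrow> p \<in> \<Union>\<U> \<rightarrow> X \<Longrightarrow>
     (\<And>U. U \<in> \<U> \<Longrightarrow> D n U p) \<Longrightarrow> D n (\<Union>\<U>) p"
  using diffeo_axioms[THEN conjunct2, THEN conjunct2, THEN conjunct2, THEN conjunct2] by simp

end

lemma C_k_on_const: "C_k_on k n U (\<lambda>x. c)"
  by (induction k arbitrary: c) (auto intro!: exI[of _ "\<lambda>x. 0"])

lemma C_k_on_coord: "C_k_on k n U (\<lambda>x. x j)"
proof -
  have c: "continuous_map (subtopology (Euclidean_space n) U) euclideanreal (\<lambda>x. x j)"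
    unfolding Euclidean_space_def
    by (intro continuous_map_from_subtopology continuous_map_product_projection) auto
  show ?thesis
  proof (cases k)
    case (Suc k')
    have "((\<lambda>t. (x(i := t)) j) has_real_derivative (if i = j then 1 else 0)) (at (x i))" for i x
      by (cases "i = j") auto
    then have "\<exists>g. (\<forall>x\<in>U. ((\<lambda>t. (x(i := t)) j) has_real_derivative g x) (at (x i))) \<and> C_k_on k' n U g" for i
      by (intro exI[of _ "\<lambda>x. if i = j then 1 else 0"] conjI ballI C_k_on_const)
    then show ?thesis
      using c unfolding Suc C_k_on.simps by blast
  qed (simp add: c)
qed

lemma smooth_between_inclusion:
  assumes "openin (Euclidean_space n) U" "openin (Euclidean_space n) V" "V \<subseteq> U"
  shows "smooth_between n V n U (\<lambda>x. x)"
  using assms C_k_on_coord by (auto simp: smooth_between_def smooth_fun_def)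

lemma diffeo_restrict:
  assumes "diffeological_space X D" "D n U p" "openin (Euclidean_space n) V" "V \<subseteq> U"
  shows "D n V p"
  using diffeo_comp[OF assms(1), OF assms(2) smooth_between_inclusion[OF diffeo_open[OF assms(1), OF assms(2)] assms(3,4)]]
  by (simp add: o_def)

lemma diffeo_local:
  assumes "diffeological_space X D"
    "\<And>u. u \<in> U \<Longrightarrow> \<exists>V. u \<in> V \<and> V \<subseteq> U \<and> D n V p"
  shows "D n U p"
proof -
  define \<U> where "\<U> = {V. V \<subseteq> U \<and> D n V p}"
  have "\<Union>\<U> = U" unfolding \<U>_def using assms(2) by blast
  moreover have "D n (\<Union>\<U>) p"
    by (rule diffeo_cover[OF assms(1)])
      (auto simp: \<U>_def diffeo_open[OF assms(1)] diffeo_in[OF assms(1)])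
  ultimately show ?thesis by simp
qed

lemma locally_liftsE:
  assumes "locally_lifts f D n U q" "u \<in> U"
  obtains V p where "openin (Euclidean_space n) V" "u \<in> V" "V \<subseteq> U" "D n V p" "\<forall>v\<in>V. q v = f (p v)"
  using bspec[OF assms(1)[unfolded locally_lifts_def] assms(2)]
  by (elim exE conjE) (rule that, assumption+)

lemma subduction_lifts: "subduction_map X DX Y DY f \<Longrightarrow> DY n U q \<Longrightarrow> locally_lifts f DX n U q"
  unfolding subduction_map_def by simp

lemma diffeo_prod:
  assumes X: "diffeological_space X D" and Y: "diffeological_space Y E"
  shows "diffeological_space (X \<times> Y) (prod_diffeology D E)"
  unfolding diffeological_space_def prod_diffeology_def
proof (intro conjI allI impI; (elim conjE)?)
  fix n U and p :: "(nat \<Rightarrow> real) \<Rightarrow> 'a \<times> 'b" assume p: "D n U (fst \<circ> p)" "E n U (snd \<circ> p)"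
  show "openin (Euclidean_space n) U" using diffeo_open[OF X, OF p(1)] .
  show "p \<in> U \<rightarrow> X \<times> Y"
    using diffeo_in[OF X, OF p(1)] diffeo_in[OF Y, OF p(2)] by (auto simp: mem_Times_iff)
next
  fix n U and p q :: "(nat \<Rightarrow> real) \<Rightarrow> 'a \<times> 'b"
  assume p: "D n U (fst \<circ> p)" "E n U (snd \<circ> p)" "\<forall>u\<in>U. q u = p u"
  show "D n U (fst \<circ> q)" by (rule diffeo_cong[OF X, OF p(1)]) (simp add: p)
  show "E n U (snd \<circ> q)" by (rule diffeo_cong[OF Y, OF p(2)]) (simp add: p)
next
  fix n U and x :: "'a \<times> 'b" assume "openin (Euclidean_space n) U" "x \<in> X \<times> Y"
  then show "D n U (fst \<circ> (\<lambda>u. x))" "E n U (snd \<circ> (\<lambda>u. x))"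
    using diffeo_const[OF X, of n U "fst x"] diffeo_const[OF Y, of n U "snd x"]
    by (simp_all add: o_def mem_Times_iff)
next
  fix n U m V h and p :: "(nat \<Rightarrow> real) \<Rightarrow> 'a \<times> 'b"
  assume "D n U (fst \<circ> p)" "E n U (snd \<circ> p)" "smooth_between m V n U h"
  then show "D m V (fst \<circ> (p \<circ> h))" "E m V (snd \<circ> (p \<circ> h))"
    using diffeo_comp[OF X, of n U "fst \<circ> p" m V h] diffeo_comp[OF Y, of n U "snd \<circ> p" m V h]
    by (simp_all add: o_assoc)
next
  fix n \<U> and p :: "(nat \<Rightarrow> real) \<Rightarrow> 'a \<times> 'b"
  assume "\<forall>U\<in>\<U>. openin (Euclidean_space n) U" "p \<in> \<Union>\<U> \<rightarrow> X \<times> Y"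
    "\<forall>U\<in>\<U>. D n U (fst \<circ> p) \<and> E n U (snd \<circ> p)"
  then show "D n (\<Union>\<U>) (fst \<circ> p)" "E n (\<Union>\<U>) (snd \<circ> p)"
    by (intro diffeo_cover[OF X] diffeo_cover[OF Y]; force)+
qed

lemma diffeo_sub:
  assumes X: "diffeological_space X D" and S: "S \<subseteq> X"
  shows "diffeological_space S (sub_diffeology S D)"
  unfolding diffeological_space_def sub_diffeology_def
proof (intro conjI allI impI; (elim conjE)?)
  fix n U p m V h assume "D n U p" "p \<in> U \<rightarrow> S" "smooth_between m V n U h"
  then show "D m V (p \<circ> h)" "p \<circ> h \<in> V \<rightarrow> S"
    using diffeo_comp[OF X, of n U p m V h] by (auto simp: smooth_between_def)
next
  fix n \<U> p assume "\<forall>U\<in>\<U>. openin (Euclidean_space n) U" "p \<in> \<Union>\<U> \<rightarrow> S" "\<forall>U\<in>\<U>. D n U p \<and> p \<in> U \<rightarrow> S"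
  then show "D n (\<Union>\<U>) p" using S by (intro diffeo_cover[OF X]) auto
next
  fix n U p q assume "D n U p" "p \<in> U \<rightarrow> S" "\<forall>u\<in>U. q u = p u"
  then show "D n U q" "q \<in> U \<rightarrow> S" using diffeo_cong[OF X, of n U p q] by auto
qed (use S diffeo_open[OF X] diffeo_const[OF X] in auto)

lemma smooth_map_comp:
  assumes "smooth_map X DX Y DY f" "smooth_map Y DY Z DZ g"
  shows "smooth_map X DX Z DZ (g \<circ> f)"
proof -
  have "DZ n U (g \<circ> f \<circ> p)" if "DX n U p" for n U p
    using assms that unfolding smooth_map_def comp_assoc by blast
  then show ?thesis using assms unfolding smooth_map_def by auto
qed

lemma dvs_hom_comp: "f \<in> dvs_hom V W \<Longrightarrow> g \<in> dvs_hom W Z \<Longrightarrow> g \<circ> f \<in> dvs_hom V Z"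
  using smooth_map_comp[of "carrier V" "plots V" "carrier W" "plots W" f "carrier Z" "plots Z" g]
  unfolding dvs_hom_def by (auto simp: smooth_map_def Pi_iff comp_assoc)

lemma dvs_hom_plot: "f \<in> dvs_hom V W \<Longrightarrow> plots V n U p \<Longrightarrow> plots W n U (\<lambda>u. f (p u))"
  unfolding dvs_hom_def smooth_map_def o_def by blast

lemma dvs_hom_in: "f \<in> dvs_hom V W \<Longrightarrow> x \<in> carrier V \<Longrightarrow> f x \<in> carrier W"
  unfolding dvs_hom_def smooth_map_def by blast

lemma dvs_hom_add:
  "f \<in> dvs_hom V W \<Longrightarrow> x \<in> carrier V \<Longrightarrow> y \<in> carrier V \<Longrightarrow> f (x \<oplus>\<^bsub>V\<^esub> y) = f x \<oplus>\<^bsub>W\<^esub> f y"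
  unfolding dvs_hom_def by blast

lemma dvs_hom_smult:
  "f \<in> dvs_hom V W \<Longrightarrow> x \<in> carrier V \<Longrightarrow> f (a \<odot>\<^bsub>V\<^esub> x) = a \<odot>\<^bsub>W\<^esub> f x"
  unfolding dvs_hom_def by blast

lemma dvs_homI:
  assumes "\<And>x. x \<in> carrier V \<Longrightarrow> f x \<in> carrier W"
    "\<And>n U p. plots V n U p \<Longrightarrow> plots W n U (\<lambda>u. f (p u))"
    "\<And>x y. x \<in> carrier V \<Longrightarrow> y \<in> carrier V \<Longrightarrow> f (x \<oplus>\<^bsub>V\<^esub> y) = f x \<oplus>\<^bsub>W\<^esub> f y"
    "\<And>a x. x \<in> carrier V \<Longrightarrow> f (a \<odot>\<^bsub>V\<^esub> x) = a \<odot>\<^bsub>W\<^esub> f x"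
  shows "f \<in> dvs_hom V W"
  using assms unfolding dvs_hom_def smooth_map_def o_def by blast

lemma cring_real_ring: "cring real_ring"
proof -
  have "\<exists>y. x + y = 0" for x :: real by (rule exI[of _ "- x"]) simp
  then show ?thesis
    unfolding real_ring_def by unfold_locales (auto simp: algebra_simps Units_def)
qed

lemma real_moduleI:
  fixes V (structure)
  assumes "\<And>x y. x \<in> carrier V \<Longrightarrow> y \<in> carrier V \<Longrightarrow> x \<oplus> y \<in> carrier V"
    "\<zero> \<in> carrier V"
    "\<And>x y z. x \<in> carrier V \<Longrightarrow> y \<in> carrier V \<Longrightarrow> z \<in> carrier V \<Longrightarrow> (x \<oplus> y) \<oplus> z = x \<oplus> (y \<oplus> z)"
    "\<And>x y. x \<in> carrier V \<Longrightarrow> y \<in> carrier V \<Longrightarrow> x \<oplus> y = y \<oplus> x"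
    "\<And>x. x \<in> carrier V \<Longrightarrow> \<zero> \<oplus> x = x"
    "\<And>a x. x \<in> carrier V \<Longrightarrow> a \<odot> x \<in> carrier V"
    "\<And>x. x \<in> carrier V \<Longrightarrow> 0 \<odot> x = \<zero>"
    "\<And>x. x \<in> carrier V \<Longrightarrow> 1 \<odot> x = x"
    "\<And>a b x. x \<in> carrier V \<Longrightarrow> (a + b) \<odot> x = a \<odot> x \<oplus> b \<odot> x"
    "\<And>a x y. x \<in> carrier V \<Longrightarrow> y \<in> carrier V \<Longrightarrow> a \<odot> (x \<oplus> y) = a \<odot> x \<oplus> a \<odot> y"
    "\<And>a b x. x \<in> carrier V \<Longrightarrow> (a * b) \<odot> x = a \<odot> (b \<odot> x)"
  shows "module real_ring V"
proof (rule moduleI[OF cring_real_ring])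
  show "abelian_group V"
  proof (rule abelian_groupI)
    fix x assume x: "x \<in> carrier V"
    have "(- 1) \<odot> x \<oplus> x = (- 1 + 1) \<odot> x" using assms(8,9) x by metis
    also have "\<dots> = \<zero>" using assms(7) x by simp
    finally show "\<exists>y\<in>carrier V. y \<oplus> x = \<zero>" using assms(6) x by blast
  qed (use assms in auto)
qed (use assms in \<open>auto simp: real_ring_def\<close>)

lemma is_dvs_diffeo: "is_dvs V \<Longrightarrow> diffeological_space (carrier V) (plots V)"
  unfolding is_dvs_def by blast

lemma is_dvs_module: "is_dvs V \<Longrightarrow> module real_ring V"
  unfolding is_dvs_def by blast

lemma
  fixes V (structure)
  assumes "is_dvs V"
  shows dvs_add_closed: "\<And>x y. x \<in> carrier V \<Longrightarrow> y \<in> carrier V \<Longrightarrow> x \<oplus> y \<in> carrier V"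
    and dvs_zero_closed: "\<zero> \<in> carrier V"
    and dvs_assoc: "\<And>x y z. x \<in> carrier V \<Longrightarrow> y \<in> carrier V \<Longrightarrow> z \<in> carrier V \<Longrightarrow> (x \<oplus> y) \<oplus> z = x \<oplus> (y \<oplus> z)"
    and dvs_comm: "\<And>x y. x \<in> carrier V \<Longrightarrow> y \<in> carrier V \<Longrightarrow> x \<oplus> y = y \<oplus> x"
    and dvs_l_zero: "\<And>x. x \<in> carrier V \<Longrightarrow> \<zero> \<oplus> x = x"
    and dvs_r_zero: "\<And>x. x \<in> carrier V \<Longrightarrow> x \<oplus> \<zero> = x"
    and dvs_smult_closed: "\<And>a x. x \<in> carrier V \<Longrightarrow> a \<odot> x \<in> carrier V"
    and dvs_smult_0: "\<And>x. x \<in> carrier V \<Longrightarrow> 0 \<odot> x = \<zero>"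
    and dvs_smult_zero: "\<And>a. a \<odot> \<zero> = \<zero>"
    and dvs_smult_1: "\<And>x. x \<in> carrier V \<Longrightarrow> 1 \<odot> x = x"
    and dvs_smult_l: "\<And>a b x. x \<in> carrier V \<Longrightarrow> (a + b) \<odot> x = a \<odot> x \<oplus> b \<odot> x"
    and dvs_smult_r: "\<And>a x y. x \<in> carrier V \<Longrightarrow> y \<in> carrier V \<Longrightarrow> a \<odot> (x \<oplus> y) = a \<odot> x \<oplus> a \<odot> y"
    and dvs_smult_assoc: "\<And>a b x. x \<in> carrier V \<Longrightarrow> (a * b) \<odot> x = a \<odot> (b \<odot> x)"
proof -
  interpret module real_ring V by (rule is_dvs_module[OF assms])
  note r = real_ring_def
  show "\<And>x y. x \<in> carrier V \<Longrightarrow> y \<in> carrier V \<Longrightarrow> x \<oplus> y \<in> carrier V"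
    "\<zero> \<in> carrier V"
    "\<And>x y z. x \<in> carrier V \<Longrightarrow> y \<in> carrier V \<Longrightarrow> z \<in> carrier V \<Longrightarrow> (x \<oplus> y) \<oplus> z = x \<oplus> (y \<oplus> z)"
    "\<And>x y. x \<in> carrier V \<Longrightarrow> y \<in> carrier V \<Longrightarrow> x \<oplus> y = y \<oplus> x"
    "\<And>x. x \<in> carrier V \<Longrightarrow> \<zero> \<oplus> x = x"
    "\<And>x. x \<in> carrier V \<Longrightarrow> x \<oplus> \<zero> = x"
    by (simp_all add: M.a_assoc) (simp add: M.a_comm)
  show "\<And>a x. x \<in> carrier V \<Longrightarrow> a \<odot> x \<in> carrier V"
    "\<And>x. x \<in> carrier V \<Longrightarrow> 0 \<odot> x = \<zero>"
    "\<And>a. a \<odot> \<zero> = \<zero>"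
    "\<And>x. x \<in> carrier V \<Longrightarrow> 1 \<odot> x = x"
    "\<And>a b x. x \<in> carrier V \<Longrightarrow> (a + b) \<odot> x = a \<odot> x \<oplus> b \<odot> x"
    "\<And>a x y. x \<in> carrier V \<Longrightarrow> y \<in> carrier V \<Longrightarrow> a \<odot> (x \<oplus> y) = a \<odot> x \<oplus> a \<odot> y"
    "\<And>a b x. x \<in> carrier V \<Longrightarrow> (a * b) \<odot> x = a \<odot> (b \<odot> x)"
    using smult_closed smult_l_null smult_r_null smult_one smult_l_distr smult_r_distr smult_assoc1
    by (simp_all add: r)
qed

lemmas dvs_simps = dvs_add_closed dvs_zero_closed dvs_assoc dvs_l_zero dvs_r_zero dvs_smult_closed
  dvs_smult_0 dvs_smult_zero dvs_smult_1 dvs_smult_l dvs_smult_r dvs_smult_assoc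

lemma dvs_plot_add:
  assumes "is_dvs V" "plots V n U p" "plots V n U q"
  shows "plots V n U (\<lambda>u. p u \<oplus>\<^bsub>V\<^esub> q u)"
proof -
  have "prod_diffeology (plots V) (plots V) n U (\<lambda>u. (p u, q u))"
    using assms by (simp add: prod_diffeology_def o_def)
  then have "plots V n U ((\<lambda>(x, y). x \<oplus>\<^bsub>V\<^esub> y) \<circ> (\<lambda>u. (p u, q u)))"
    using assms(1) unfolding is_dvs_def smooth_map_def by blast
  then show ?thesis by (simp add: o_def)
qed

lemma dvs_plot_smult:
  assumes "is_dvs V" "smooth_fun n U a" "plots V n U p"
  shows "plots V n U (\<lambda>u. a u \<odot>\<^bsub>V\<^esub> p u)"
proof -
  have "prod_diffeology real_diffeology (plots V) n U (\<lambda>u. (a u, p u))"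
    using assms by (simp add: prod_diffeology_def o_def real_diffeology_def)
  then have "plots V n U ((\<lambda>(x, y). x \<odot>\<^bsub>V\<^esub> y) \<circ> (\<lambda>u. (a u, p u)))"
    using assms(1) unfolding is_dvs_def smooth_map_def by blast
  then show ?thesis by (simp add: o_def)
qed

lemma is_dvsI:
  assumes m: "module real_ring V" and "diffeological_space (carrier V) (plots V)"
    and add: "\<And>n U p q. plots V n U p \<Longrightarrow> plots V n U q \<Longrightarrow> plots V n U (\<lambda>u. p u \<oplus>\<^bsub>V\<^esub> q u)"
    and smult: "\<And>n U a p. smooth_fun n U a \<Longrightarrow> plots V n U p \<Longrightarrow> plots V n U (\<lambda>u. a u \<odot>\<^bsub>V\<^esub> p u)"
  shows "is_dvs V"
proof -
  interpret module real_ring V by fact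
  have "a \<odot>\<^bsub>V\<^esub> x \<in> carrier V" if "x \<in> carrier V" for a x
    using smult_closed[of a x] that by (simp add: real_ring_def)
  moreover have "plots V n U ((\<lambda>(x, y). x \<oplus>\<^bsub>V\<^esub> y) \<circ> p)"
    if "prod_diffeology (plots V) (plots V) n U p" for n U p
    using add[of n U "fst \<circ> p" "snd \<circ> p"] that by (simp add: prod_diffeology_def o_def split_beta)
  moreover have "plots V n U ((\<lambda>(a, x). a \<odot>\<^bsub>V\<^esub> x) \<circ> p)"
    if "prod_diffeology real_diffeology (plots V) n U p" for n U p
    using smult[of n U "fst \<circ> p" "snd \<circ> p"] that
    by (simp add: prod_diffeology_def real_diffeology_def o_def split_beta)
  ultimately show ?thesis
    using assms(1,2) unfolding is_dvs_def smooth_map_def by auto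
qed

lemma direct_sum_simps [simp]:
  "carrier (V \<oplus>\<^sub>D W) = carrier V \<times> carrier W"
  "\<zero>\<^bsub>V \<oplus>\<^sub>D W\<^esub> = (\<zero>\<^bsub>V\<^esub>, \<zero>\<^bsub>W\<^esub>)"
  "x \<oplus>\<^bsub>V \<oplus>\<^sub>D W\<^esub> y = (fst x \<oplus>\<^bsub>V\<^esub> fst y, snd x \<oplus>\<^bsub>W\<^esub> snd y)"
  "a \<odot>\<^bsub>V \<oplus>\<^sub>D W\<^esub> x = (a \<odot>\<^bsub>V\<^esub> fst x, a \<odot>\<^bsub>W\<^esub> snd x)"
  "plots (V \<oplus>\<^sub>D W) = prod_diffeology (plots V) (plots W)"
  by (simp_all add: direct_sum_def)

lemma is_dvs_direct_sum:
  assumes V: "is_dvs V" and W: "is_dvs W"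
  shows "is_dvs (V \<oplus>\<^sub>D W)"
proof (rule is_dvsI)
  show "module real_ring (V \<oplus>\<^sub>D W)"
    by (rule real_moduleI)
      (auto simp: dvs_simps[OF V] dvs_simps[OF W] intro: dvs_comm[OF V] dvs_comm[OF W])
  show "diffeological_space (carrier (V \<oplus>\<^sub>D W)) (plots (V \<oplus>\<^sub>D W))"
    by (simp add: diffeo_prod is_dvs_diffeo V W)
qed (auto simp: prod_diffeology_def o_def dvs_plot_add[OF V] dvs_plot_add[OF W]
    dvs_plot_smult[OF V] dvs_plot_smult[OF W])

lemma sub_dvs_simps [simp]:
  "carrier (sub_dvs V S) = S" "\<zero>\<^bsub>sub_dvs V S\<^esub> = \<zero>\<^bsub>V\<^esub>" "add (sub_dvs V S) = add V"
  "module.smult (sub_dvs V S) = module.smult V" "plots (sub_dvs V S) = sub_diffeology S (plots V)"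
  by (simp_all add: sub_dvs_def)

lemma is_dvs_sub_dvs:
  assumes V: "is_dvs V" and S: "S \<subseteq> carrier V" "\<zero>\<^bsub>V\<^esub> \<in> S"
    and add: "\<And>x y. x \<in> S \<Longrightarrow> y \<in> S \<Longrightarrow> x \<oplus>\<^bsub>V\<^esub> y \<in> S" and smult: "\<And>a x. x \<in> S \<Longrightarrow> a \<odot>\<^bsub>V\<^esub> x \<in> S"
  shows "is_dvs (sub_dvs V S)"
proof (rule is_dvsI)
  have [simp]: "x \<in> S \<Longrightarrow> x \<in> carrier V" for x using S by blast
  show "module real_ring (sub_dvs V S)"
    by (rule real_moduleI) (auto simp: S add smult dvs_simps[OF V] intro: dvs_comm[OF V])
  show "diffeological_space (carrier (sub_dvs V S)) (plots (sub_dvs V S))"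
    using diffeo_sub[OF is_dvs_diffeo[OF V] S(1)] by simp
qed (auto simp: sub_diffeology_def Pi_iff add smult dvs_plot_add[OF V] dvs_plot_smult[OF V])


section \<open>Lifting against diffeological vector spaces over arbitrary types\<close>

text \<open>
  Given a subduction \<open>f\<close> from \<open>W1\<close> to \<open>W2\<close> and \<open>g\<close> from \<open>V\<close> to \<open>W2\<close>, choose a lift to \<open>W1\<close> of \<open>g \<circ> p\<close> for
  each plot \<open>p\<close> of \<open>V\<close> that has one. The span \<open>S\<close> of the values of these lifts, paired with those of \<open>p\<close>,
  inside the fibre product of \<open>f\<close> and \<open>g\<close> still subducts onto \<open>V\<close> and embeds into the test type.
  \<open>copy_dvs e V\<close> transports the structure of \<open>V\<close> along an injection \<open>e\<close>.
\<close>

definition copy_dvs :: "('a \<Rightarrow> 'b) \<Rightarrow> 'a dvs \<Rightarrow> 'b dvs" where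
  "copy_dvs e V = (let e' = inv_into (carrier V) e in
     \<lparr>carrier = e ` carrier V, mult = undefined, one = undefined, zero = e \<zero>\<^bsub>V\<^esub>,
      add = (\<lambda>x y. e (e' x \<oplus>\<^bsub>V\<^esub> e' y)), smult = (\<lambda>a x. e (a \<odot>\<^bsub>V\<^esub> e' x)),
      plots = (\<lambda>n U p. p \<in> U \<rightarrow> e ` carrier V \<and> plots V n U (e' \<circ> p))\<rparr>)"

context
  fixes V :: "'a dvs" and e :: "'a \<Rightarrow> 'b"
  assumes V: "is_dvs V" and e: "inj_on e (carrier V)"
begin

lemma copy_inv [simp]: "x \<in> carrier V \<Longrightarrow> inv_into (carrier V) e (e x) = x"
  using e by simp

lemma copy_simps [simp]:
  "carrier (copy_dvs e V) = e ` carrier V"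
  "\<zero>\<^bsub>copy_dvs e V\<^esub> = e \<zero>\<^bsub>V\<^esub>"
  "x \<oplus>\<^bsub>copy_dvs e V\<^esub> y = e (inv_into (carrier V) e x \<oplus>\<^bsub>V\<^esub> inv_into (carrier V) e y)"
  "a \<odot>\<^bsub>copy_dvs e V\<^esub> x = e (a \<odot>\<^bsub>V\<^esub> inv_into (carrier V) e x)"
  "plots (copy_dvs e V) n U p \<longleftrightarrow> p \<in> U \<rightarrow> e ` carrier V \<and> plots V n U (inv_into (carrier V) e \<circ> p)"
  by (simp_all add: copy_dvs_def Let_def)

lemma is_dvs_copy: "is_dvs (copy_dvs e V)"
proof (rule is_dvsI)
  note D = is_dvs_diffeo[OF V]
  show "module real_ring (copy_dvs e V)"
    by (rule real_moduleI) (auto simp: dvs_simps[OF V] dvs_comm[OF V, of "inv_into _ _ _"] intro!: arg_cong[of _ _ e] intro: dvs_comm[OF V])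
  show "diffeological_space (carrier (copy_dvs e V)) (plots (copy_dvs e V))"
    unfolding diffeological_space_def copy_simps
  proof (intro conjI allI impI; (elim conjE)?)
    fix n U p q assume "p \<in> U \<rightarrow> e ` carrier V" "plots V n U (inv_into (carrier V) e \<circ> p)" "\<forall>u\<in>U. q u = p u"
    then show "q \<in> U \<rightarrow> e ` carrier V" "plots V n U (inv_into (carrier V) e \<circ> q)"
      using diffeo_cong[OF D, of n U "inv_into (carrier V) e \<circ> p" "inv_into (carrier V) e \<circ> q"]
      by (auto simp: Pi_iff)
  next
    fix n U p m W h
    assume "p \<in> U \<rightarrow> e ` carrier V" "plots V n U (inv_into (carrier V) e \<circ> p)" "smooth_between m W n U h"
    then show "p \<circ> h \<in> W \<rightarrow> e ` carrier V" "plots V m W (inv_into (carrier V) e \<circ> (p \<circ> h))"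
      using diffeo_comp[OF D, of n U "inv_into (carrier V) e \<circ> p" m W h]
      by (auto simp: smooth_between_def o_assoc Pi_iff)
  next
    fix n \<U> p assume "\<forall>U\<in>\<U>. openin (Euclidean_space n) U"
      "\<forall>U\<in>\<U>. p \<in> U \<rightarrow> e ` carrier V \<and> plots V n U (inv_into (carrier V) e \<circ> p)"
    then show "plots V n (\<Union>\<U>) (inv_into (carrier V) e \<circ> p)"
      by (intro diffeo_cover[OF D]) (auto simp: inv_into_into Pi_iff)
  qed (use diffeo_open[OF D] diffeo_const[OF D] in \<open>auto simp: o_def\<close>)
next
  let ?e = "inv_into (carrier V) e"
  fix n U p q assume pq: "plots (copy_dvs e V) n U p" "plots (copy_dvs e V) n U q"
  then have c: "?e (p u) \<oplus>\<^bsub>V\<^esub> ?e (q u) \<in> carrier V" if "u \<in> U" for u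
    using that by (auto intro!: dvs_add_closed[OF V] inv_into_into)
  have "plots V n U (\<lambda>u. ?e (p u) \<oplus>\<^bsub>V\<^esub> ?e (q u))"
    using dvs_plot_add[OF V] pq by (auto simp: o_def)
  then have "plots V n U (\<lambda>u. ?e (p u \<oplus>\<^bsub>copy_dvs e V\<^esub> q u))"
    by (rule diffeo_cong[OF is_dvs_diffeo[OF V]]) (simp add: c)
  then show "plots (copy_dvs e V) n U (\<lambda>u. p u \<oplus>\<^bsub>copy_dvs e V\<^esub> q u)"
    using c by (auto simp: o_def)
next
  let ?e = "inv_into (carrier V) e"
  fix n U a p assume ap: "smooth_fun n U a" "plots (copy_dvs e V) n U p"
  then have c: "a u \<odot>\<^bsub>V\<^esub> ?e (p u) \<in> carrier V" if "u \<in> U" for u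
    using that by (auto intro!: dvs_smult_closed[OF V] inv_into_into)
  have "plots V n U (\<lambda>u. a u \<odot>\<^bsub>V\<^esub> ?e (p u))"
    using dvs_plot_smult[OF V] ap by (auto simp: o_def)
  then have "plots V n U (\<lambda>u. ?e (a u \<odot>\<^bsub>copy_dvs e V\<^esub> p u))"
    by (rule diffeo_cong[OF is_dvs_diffeo[OF V]]) (simp add: c)
  then show "plots (copy_dvs e V) n U (\<lambda>u. a u \<odot>\<^bsub>copy_dvs e V\<^esub> p u)"
    using c by (auto simp: o_def)
qed

lemma copy_hom: "e \<in> dvs_hom V (copy_dvs e V)"
proof (rule dvs_homI)
  fix n U p assume p: "plots V n U p"
  have "plots V n U (\<lambda>u. inv_into (carrier V) e (e (p u)))"
    by (rule diffeo_cong[OF is_dvs_diffeo[OF V], OF p]) (simp add: diffeo_in[OF is_dvs_diffeo[OF V], OF p])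
  then show "plots (copy_dvs e V) n U (\<lambda>u. e (p u))"
    using diffeo_in[OF is_dvs_diffeo[OF V], OF p] by (auto simp: o_def)
qed auto

lemma copy_inv_hom: "inv_into (carrier V) e \<in> dvs_hom (copy_dvs e V) V"
  by (rule dvs_homI) (auto simp: o_def dvs_simps[OF V])

end


fun lin_eval :: "'b dvs \<Rightarrow> ('k \<Rightarrow> 'b) \<Rightarrow> (real \<times> 'k) list \<Rightarrow> 'b" where
  "lin_eval E l [] = \<zero>\<^bsub>E\<^esub>"
| "lin_eval E l ((a, k) # xs) = (a \<odot>\<^bsub>E\<^esub> l k) \<oplus>\<^bsub>E\<^esub> lin_eval E l xs"

theorem projective_lift:
  fixes V :: "'a dvs" and W1 :: "'b dvs" and W2 :: "'c dvs"
  assumes pr: "projective V" and W1: "is_dvs W1" and f: "f \<in> dvs_hom W1 W2"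
    and sub: "subduction W1 W2 f" and g: "g \<in> dvs_hom V W2" and W2: "is_dvs W2"
  shows "\<exists>h\<in>dvs_hom V W1. \<forall>x\<in>carrier V. g x = f (h x)"
proof -
  have V: "is_dvs V" using pr unfolding projective_def by blast
  define E where "E = W1 \<oplus>\<^sub>D V"
  have E: "is_dvs E" unfolding E_def by (rule is_dvs_direct_sum[OF W1 V])
  define lifts where
    "lifts = (\<lambda>(n, U, p) q. plots W1 n U q \<and> (\<forall>u\<in>U. g (p u) = f (q u)))"
  define I where "I = {(n, U, p). plots V n U p \<and> (\<exists>q. lifts (n, U, p) q)}"
  define lift where "lift i = (SOME q. lifts i q)" for i
  define J where "J = {(i, u). i \<in> I \<and> u \<in> fst (snd i)}"
  define l where "l = (\<lambda>(i, u). (lift i u, snd (snd i) u))"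
  define L where "L = {xs :: 'a test. snd ` set xs \<subseteq> J}"
  define S where "S = lin_eval E l ` L"
  have lift: "lifts i (lift i)" if "i \<in> I" for i
    using that unfolding lift_def I_def by (auto intro: someI[of "lifts i" for i])
  have l: "l k \<in> carrier E \<and> g (snd (l k)) = f (fst (l k))" if k: "k \<in> J" for k
  proof -
    obtain n U p u where k': "k = ((n, U, p), u)" by (metis prod.exhaust)
    then have i: "(n, U, p) \<in> I" "u \<in> U" "plots V n U p" using k by (auto simp: J_def I_def)
    have "plots W1 n U (lift (n, U, p))" "g (p u) = f (lift (n, U, p) u)"
      using lift[OF i(1)] i(2) by (auto simp: lifts_def)
    then show ?thesis
      using diffeo_in[OF is_dvs_diffeo[OF V], OF i(3), OF i(2)] diffeo_in[OF is_dvs_diffeo[OF W1], of n U _ u]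
      using i(2) by (simp add: k' l_def E_def)
  qed
  have ev: "lin_eval E l xs \<in> carrier E \<and> g (snd (lin_eval E l xs)) = f (fst (lin_eval E l xs))"
    if "xs \<in> L" for xs
    using that
  proof (induction xs)
    case Nil
    have "g \<zero>\<^bsub>V\<^esub> = 0 \<odot>\<^bsub>W2\<^esub> g \<zero>\<^bsub>V\<^esub>" "f \<zero>\<^bsub>W1\<^esub> = 0 \<odot>\<^bsub>W2\<^esub> f \<zero>\<^bsub>W1\<^esub>"
      using dvs_hom_smult[OF g, of "\<zero>\<^bsub>V\<^esub>" 0] dvs_hom_smult[OF f, of "\<zero>\<^bsub>W1\<^esub>" 0]
      by (simp_all add: dvs_simps[OF V] dvs_simps[OF W1])
    then have "g \<zero>\<^bsub>V\<^esub> = f \<zero>\<^bsub>W1\<^esub>"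
      using dvs_hom_in[OF g] dvs_hom_in[OF f] by (simp add: dvs_simps[OF V] dvs_simps[OF W1] dvs_simps[OF W2])
    then show ?case by (simp add: E_def dvs_simps[OF V] dvs_simps[OF W1])
  next
    case (Cons y xs)
    obtain a k where y: "y = (a, k)" by (metis prod.exhaust)
    have k: "k \<in> J" and xs: "xs \<in> L" using Cons.prems by (auto simp: L_def y)
    show ?case using l[OF k] Cons.IH[OF xs]
      by (auto simp: y E_def mem_Times_iff dvs_simps[OF V] dvs_simps[OF W1]
          dvs_hom_add[OF f] dvs_hom_add[OF g] dvs_hom_smult[OF f] dvs_hom_smult[OF g])
  qed
  have append: "lin_eval E l (xs @ ys) = lin_eval E l xs \<oplus>\<^bsub>E\<^esub> lin_eval E l ys"
    if "xs \<in> L" "ys \<in> L" for xs ys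
    using that(1)
  proof (induction xs)
    case Nil
    then show ?case using ev[OF that(2)] by (simp add: dvs_l_zero[OF E])
  next
    case (Cons y xs)
    obtain a k where y: "y = (a, k)" by (metis prod.exhaust)
    have k: "k \<in> J" and xs: "xs \<in> L" using Cons.prems by (auto simp: L_def y)
    show ?case using l[OF k] ev[OF xs] ev[OF that(2)] Cons.IH[OF xs]
      by (simp add: y dvs_assoc[OF E] dvs_smult_closed[OF E])
  qed
  have scale: "lin_eval E l (map (map_prod ((*) c) id) xs) = c \<odot>\<^bsub>E\<^esub> lin_eval E l xs"
    if "xs \<in> L" for xs c
    using that
  proof (induction xs)
    case Nil
    then show ?case by (simp add: dvs_smult_zero[OF E])
  next
    case (Cons y xs)
    obtain a k where y: "y = (a, k)" by (metis prod.exhaust)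
    have k: "k \<in> J" and xs: "xs \<in> L" using Cons.prems by (auto simp: L_def y)
    show ?case using l[OF k] ev[OF xs] Cons.IH[OF xs]
      by (simp add: y dvs_smult_assoc[OF E] dvs_smult_closed[OF E] dvs_smult_r[OF E])
  qed
  define T where "T = sub_dvs E S"
  have T: "is_dvs T"
    unfolding T_def
  proof (rule is_dvs_sub_dvs[OF E])
    show "S \<subseteq> carrier E" using ev by (auto simp: S_def)
    show "\<zero>\<^bsub>E\<^esub> \<in> S" unfolding S_def by (rule image_eqI[of _ _ "[]"]) (auto simp: L_def)
  next
    fix x y assume "x \<in> S" "y \<in> S"
    then obtain xs ys where "xs \<in> L" "ys \<in> L" "x = lin_eval E l xs" "y = lin_eval E l ys"
      by (auto simp: S_def)
    then show "x \<oplus>\<^bsub>E\<^esub> y \<in> S"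
      unfolding S_def by (intro image_eqI[of _ _ "xs @ ys"]) (auto simp: append, auto simp: L_def)
  next
    fix c x assume "x \<in> S"
    then obtain xs where "xs \<in> L" "x = lin_eval E l xs" by (auto simp: S_def)
    then show "c \<odot>\<^bsub>E\<^esub> x \<in> S"
      unfolding S_def by (intro image_eqI[of _ _ "map (map_prod ((*) c) id) xs"]) (auto simp: scale, auto simp: L_def)
  qed
  have cT: "carrier T = S" by (simp add: T_def)
  have loc: "\<exists>V' s. openin (Euclidean_space n) V' \<and> u \<in> V' \<and> V' \<subseteq> U \<and> plots T n V' s \<and>
      (\<forall>v\<in>V'. snd (s v) = p v)" if p: "plots V n U p" and u: "u \<in> U" for n U p u
  proof -
    have "plots W2 n U (\<lambda>u. g (p u))" by (rule dvs_hom_plot[OF g p])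
    then have "locally_lifts f (plots W1) n U (\<lambda>u. g (p u))" by (rule subduction_lifts[OF sub])
    then obtain V' q where q: "openin (Euclidean_space n) V'" "u \<in> V'" "V' \<subseteq> U" "plots W1 n V' q"
      "\<forall>v\<in>V'. g (p v) = f (q v)"
      using u by (rule locally_liftsE)
    have pV': "plots V n V' p" by (rule diffeo_restrict[OF is_dvs_diffeo[OF V], OF p, OF q(1,3)])
    then have i: "(n, V', p) \<in> I" using q unfolding I_def lifts_def by auto
    define s where "s v = l ((n, V', p), v)" for v
    have "plots E n V' s"
      using lift[OF i] pV' by (simp add: E_def prod_diffeology_def s_def l_def o_def lifts_def)
    moreover have "s v \<in> S" if "v \<in> V'" for v
    proof -
      have k: "((n, V', p), v) \<in> J" using i that by (simp add: J_def)
      then have "lin_eval E l [(1, ((n, V', p), v))] = s v"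
        using l[OF k] by (simp add: s_def dvs_simps[OF E])
      then show ?thesis unfolding S_def using k by (intro image_eqI[of _ _ "[(1, ((n, V', p), v))]"]) (auto simp: L_def)
    qed
    ultimately have "plots T n V' s" by (simp add: T_def sub_diffeology_def)
    then show ?thesis using q by (intro exI[of _ V'] exI[of _ s]) (auto simp: s_def l_def)
  qed
  have snd_hom: "snd \<in> dvs_hom T V"
  proof (rule dvs_homI)
    have "S \<subseteq> carrier E" using ev by (auto simp: S_def)
    then show "snd x \<in> carrier V" if "x \<in> carrier T" for x using that by (auto simp: T_def E_def)
  qed (auto simp: T_def E_def sub_diffeology_def prod_diffeology_def o_def)
  have fst_hom: "fst \<in> dvs_hom T W1"
  proof (rule dvs_homI)
    have "S \<subseteq> carrier E" using ev by (auto simp: S_def)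
    then show "fst x \<in> carrier W1" if "x \<in> carrier T" for x using that by (auto simp: T_def E_def)
  qed (auto simp: T_def E_def sub_diffeology_def prod_diffeology_def o_def)
  have snd_surj: "snd ` S = carrier V"
  proof
    show "snd ` S \<subseteq> carrier V" using dvs_hom_in[OF snd_hom] by (auto simp: cT)
    show "carrier V \<subseteq> snd ` S"
    proof
      fix x assume "x \<in> carrier V"
      then have "plots V 0 (topspace (Euclidean_space 0)) (\<lambda>_. x)"
        by (intro diffeo_const[OF is_dvs_diffeo[OF V]]) auto
      moreover have "(\<lambda>_. 0) \<in> topspace (Euclidean_space 0)" by (simp add: topspace_Euclidean_space)
      ultimately obtain V' s where V': "(\<lambda>_. 0) \<in> V'" and s: "plots T 0 V' s" and "\<forall>v\<in>V'. snd (s v) = x"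
        using loc[of 0 "topspace (Euclidean_space 0)" "\<lambda>_. x" "\<lambda>_. 0"] by metis
      moreover have "s (\<lambda>_. 0) \<in> S"
        using diffeo_in[OF is_dvs_diffeo[OF T], OF s, OF V'] cT by simp
      ultimately show "x \<in> snd ` S" by force
    qed
  qed
  define e where "e = inv_into L (lin_eval E l)"
  have e: "inj_on e (carrier T)" unfolding e_def cT S_def by (rule inj_on_inv_into) simp
  define e2 :: "'a \<Rightarrow> 'a test" where "e2 v = [(0, (0, {}, \<lambda>_. v), \<lambda>_. 0)]" for v
  have e2: "inj_on e2 (carrier V)" by (auto simp: inj_on_def e2_def fun_eq_iff)
  define r where "r = inv_into (carrier T) e"
  have r_e: "r (e x) = x" if "x \<in> S" for x using that e by (simp add: r_def cT)
  have r: "r \<in> dvs_hom (copy_dvs e T) T" unfolding r_def by (rule copy_inv_hom[OF T e])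
  define f' where "f' = e2 \<circ> (snd \<circ> r)"
  have f': "f' \<in> dvs_hom (copy_dvs e T) (copy_dvs e2 V)"
    unfolding f'_def by (intro dvs_hom_comp[OF dvs_hom_comp[OF r snd_hom] copy_hom[OF V e2]])
  have "subduction (copy_dvs e T) (copy_dvs e2 V) f'"
    unfolding subduction_map_def
  proof (intro conjI allI impI)
    show "smooth_map (carrier (copy_dvs e T)) (plots (copy_dvs e T)) (carrier (copy_dvs e2 V)) (plots (copy_dvs e2 V)) f'"
      using f' unfolding dvs_hom_def by blast
    have "f' ` carrier (copy_dvs e T) = e2 ` snd ` S"
      using r_e by (force simp: copy_simps[OF T e] f'_def cT)
    then show "f' ` carrier (copy_dvs e T) = carrier (copy_dvs e2 V)"
      by (simp add: copy_simps[OF V e2] snd_surj)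
  next
    fix n U q assume q: "plots (copy_dvs e2 V) n U q"
    define p where "p = inv_into (carrier V) e2 \<circ> q"
    have p: "plots V n U p" and qp: "\<And>u. u \<in> U \<Longrightarrow> q u = e2 (p u)"
      using q by (auto simp: copy_simps[OF V e2] p_def f_inv_into_f Pi_iff)
    show "locally_lifts f' (plots (copy_dvs e T)) n U q"
      unfolding locally_lifts_def
    proof
      fix u assume u: "u \<in> U"
      obtain V' s where s: "openin (Euclidean_space n) V'" "u \<in> V'" "V' \<subseteq> U" "plots T n V' s"
        "\<forall>v\<in>V'. snd (s v) = p v" using loc[OF p u] by blast
      have sS: "s v \<in> S" if "v \<in> V'" for v using diffeo_in[OF is_dvs_diffeo[OF T], OF s(4), OF that] cT by simp
      have "plots (copy_dvs e T) n V' (\<lambda>v. e (s v))" by (rule dvs_hom_plot[OF copy_hom[OF T e] s(4)])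
      moreover have "q v = f' (e (s v))" if "v \<in> V'" for v
        using s that sS[OF that] qp by (auto simp: f'_def r_e)
      ultimately show "\<exists>V p. openin (Euclidean_space n) V \<and> u \<in> V \<and> V \<subseteq> U \<and> plots (copy_dvs e T) n V p \<and>
          (\<forall>v\<in>V. q v = f' (p v))"
        using s(1-3) by blast
    qed
  qed
  then obtain h where h: "h \<in> dvs_hom V (copy_dvs e T)" "\<forall>x\<in>carrier V. e2 x = f' (h x)"
    using pr is_dvs_copy[OF T e] is_dvs_copy[OF V e2] f' copy_hom[OF V e2]
    unfolding projective_def by blast
  have "fst \<circ> (r \<circ> h) \<in> dvs_hom V W1" by (intro dvs_hom_comp[OF dvs_hom_comp[OF h(1) r] fst_hom])
  moreover have "g x = f ((fst \<circ> (r \<circ> h)) x)" if x: "x \<in> carrier V" for x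
  proof -
    have rS: "r (h x) \<in> S" using dvs_hom_in[OF r dvs_hom_in[OF h(1) x]] cT by simp
    have "e2 x = e2 (snd (r (h x)))" using h(2) x by (simp add: f'_def)
    then have "x = snd (r (h x))"
      using e2 x rS snd_surj by (auto simp: inj_on_def)
    moreover have "g (snd (r (h x))) = f (fst (r (h x)))" using rS ev by (auto simp: S_def)
    ultimately show ?thesis by simp
  qed
  ultimately show ?thesis by blast
qed


section \<open>Agreement of the two forms of projective resolutions\<close>

lemma zero_dvs_plots:
  assumes "is_dvs Z" "carrier Z = {\<zero>\<^bsub>Z\<^esub>}"
  shows "plots Z n U p \<longleftrightarrow> openin (Euclidean_space n) U \<and> (\<forall>u\<in>U. p u = \<zero>\<^bsub>Z\<^esub>)"
proof
  note D = is_dvs_diffeo[OF assms(1)]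
  show "openin (Euclidean_space n) U \<and> (\<forall>u\<in>U. p u = \<zero>\<^bsub>Z\<^esub>)" if p: "plots Z n U p"
    using diffeo_open[OF D, OF p] diffeo_in[OF D, OF p] assms(2) by blast
  assume p: "openin (Euclidean_space n) U \<and> (\<forall>u\<in>U. p u = \<zero>\<^bsub>Z\<^esub>)"
  then have "plots Z n U (\<lambda>_. \<zero>\<^bsub>Z\<^esub>)" using diffeo_const[OF D] assms(2) by blast
  then show "plots Z n U p" by (rule diffeo_cong[OF D]) (simp add: p)
qed

lemma is_dvs_zeroI:
  fixes Z (structure)
  assumes "carrier Z = {\<zero>}" "\<zero> \<oplus> \<zero> = \<zero>" "\<And>a. a \<odot> \<zero> = \<zero>"
    and p: "\<And>n U p. plots Z n U p \<longleftrightarrow> openin (Euclidean_space n) U \<and> (\<forall>u\<in>U. p u = \<zero>)"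
  shows "is_dvs Z"
proof (rule is_dvsI)
  show "module real_ring Z" by (rule real_moduleI) (auto simp: assms)
  show "diffeological_space (carrier Z) (plots Z)"
    unfolding diffeological_space_def p by (auto simp: assms(1) smooth_between_def Pi_iff)
qed (auto simp: p assms)

lemma is_dvs_zero_dvs: "is_dvs zero_dvs"
  by (rule is_dvs_zeroI) (auto simp: zero_dvs_def)

lemma short_exact_zero:
  assumes B: "is_dvs B" "carrier B = {\<zero>\<^bsub>B\<^esub>}" and p: "p \<in> carrier E \<rightarrow> carrier B"
  shows "short_exact A i E p B \<longleftrightarrow> is_dvs A \<and> is_dvs E \<and> i \<in> dvs_hom A E \<and> inj_on i (carrier A) \<and>
    i ` carrier A = carrier E \<and> induction A E i"
proof -
  have "p \<in> dvs_hom E B \<and> a_kernel E B p = carrier E \<and> p ` carrier E = carrier B \<and> subduction E B p"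
    if E: "is_dvs E"
  proof -
    have p0: "p x = \<zero>\<^bsub>B\<^esub>" if "x \<in> carrier E" for x using p B that by auto
    have hom: "p \<in> dvs_hom E B"
      by (rule dvs_homI)
        (auto simp: p0 B dvs_simps[OF B(1)] dvs_simps[OF E] zero_dvs_plots[OF B]
          diffeo_open[OF is_dvs_diffeo[OF E]] diffeo_in[OF is_dvs_diffeo[OF E]])
    have im: "p ` carrier E = carrier B" using p0 B(2) dvs_zero_closed[OF E] by force
    moreover have "locally_lifts p (plots E) n U q" if "plots B n U q" for n U q
      unfolding locally_lifts_def
    proof
      fix u assume "u \<in> U"
      have "openin (Euclidean_space n) U" using that by (simp add: zero_dvs_plots[OF B])
      moreover from this have "plots E n U (\<lambda>_. \<zero>\<^bsub>E\<^esub>)"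
        by (rule diffeo_const[OF is_dvs_diffeo[OF E]]) (rule dvs_zero_closed[OF E])
      moreover have "\<forall>v\<in>U. q v = p \<zero>\<^bsub>E\<^esub>"
        using that by (simp add: zero_dvs_plots[OF B] p0 dvs_zero_closed[OF E])
      ultimately show "\<exists>V p'. openin (Euclidean_space n) V \<and> u \<in> V \<and> V \<subseteq> U \<and> plots E n V p' \<and>
          (\<forall>v\<in>V. q v = p (p' v))"
        using \<open>u \<in> U\<close> by blast
    qed
    ultimately show ?thesis
      using hom unfolding subduction_map_def by (auto simp: dvs_hom_def a_kernel_def' p0)
  qed
  then show ?thesis using B unfolding short_exact_def by auto
qed

lemma exact_at_zero:
  assumes Z: "is_dvs Z" "carrier Z = {\<zero>\<^bsub>Z\<^esub>}" and Y: "is_dvs Y" and e: "e \<in> dvs_hom Y Z"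
    and Q: "Q = quotient_dvs X (a_kernel X Y d)" and i: "i = (\<lambda>C. the_elem (d ` C))"
  shows "exact_at X d Y e Z \<longleftrightarrow>
    is_dvs Q \<and> is_dvs Y \<and> i \<in> dvs_hom Q Y \<and> inj_on i (carrier Q) \<and> i ` carrier Q = carrier Y \<and> induction Q Y i"
proof -
  have im: "e ` carrier Y = {\<zero>\<^bsub>Z\<^esub>}"
    using dvs_hom_in[OF e] Z dvs_zero_closed[OF Y] by force
  have "is_dvs (sub_dvs Z {\<zero>\<^bsub>Z\<^esub>})"
    by (rule is_dvs_sub_dvs) (use Z in \<open>auto simp: dvs_simps[OF Z(1)]\<close>)
  then show ?thesis
    unfolding exact_at_def im Q i
    by (rule short_exact_zero) (use dvs_hom_in[OF e] Z in auto)
qed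

lemma exact_at_zero_zero:
  assumes X: "is_dvs X" and Y: "is_dvs Y" "carrier Y = {\<zero>\<^bsub>Y\<^esub>}" and Z: "is_dvs Z" "carrier Z = {\<zero>\<^bsub>Z\<^esub>}"
    and d: "d \<in> dvs_hom X Y" and e: "e \<in> dvs_hom Y Z"
  shows "exact_at X d Y e Z"
proof -
  interpret X: module real_ring X by (rule is_dvs_module[OF X])
  let ?K = "carrier X" and ?Q = "quotient_dvs X (carrier X)"
  have d0: "d x = \<zero>\<^bsub>Y\<^esub>" if "x \<in> carrier X" for x using dvs_hom_in[OF d that] Y by simp
  have K: "a_kernel X Y d = ?K" by (auto simp: a_kernel_def' d0)
  have coset: "?K +>\<^bsub>X\<^esub> x = ?K" if x: "x \<in> ?K" for x
  proof
    show "?K \<subseteq> ?K +>\<^bsub>X\<^esub> x"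
    proof
      fix y assume y: "y \<in> ?K"
      then have "y = (y \<ominus>\<^bsub>X\<^esub> x) \<oplus>\<^bsub>X\<^esub> x"
        using x by (simp add: a_minus_def X.a_assoc X.l_neg)
      then show "y \<in> ?K +>\<^bsub>X\<^esub> x" using x y unfolding a_r_coset_def' by blast
    qed
  qed (use x in \<open>auto simp: a_r_coset_def'\<close>)
  have zX: "\<zero>\<^bsub>X\<^esub> \<in> ?K" by simp
  have add: "S <+>\<^bsub>X\<^esub> T = ?K" if "S = ?K" "T \<subseteq> ?K" "T \<noteq> {}" for S T
  proof -
    obtain t where t: "t \<in> T" using \<open>T \<noteq> {}\<close> by blast
    have "?K +>\<^bsub>X\<^esub> t \<subseteq> S <+>\<^bsub>X\<^esub> T" using that t by (auto simp: a_r_coset_def' set_add_def')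
    moreover have "S <+>\<^bsub>X\<^esub> T \<subseteq> ?K" using that by (auto simp: set_add_def')
    ultimately show ?thesis using coset that t by blast
  qed
  have cQ: "carrier ?Q = {?K}"
    using coset zX by (force simp: quotient_dvs_def A_RCOSETS_def')
  have pQ: "plots ?Q n U q \<longleftrightarrow> openin (Euclidean_space n) U \<and> (\<forall>u\<in>U. q u = ?K)" for n U q
  proof
    assume q: "plots ?Q n U q"
    then show "openin (Euclidean_space n) U \<and> (\<forall>u\<in>U. q u = ?K)"
      using coset diffeo_in[OF is_dvs_diffeo[OF X]]
      by (auto simp: quotient_dvs_def quotient_diffeology_def locally_lifts_def)
  next
    assume q: "openin (Euclidean_space n) U \<and> (\<forall>u\<in>U. q u = ?K)"
    then have "plots X n U (\<lambda>_. \<zero>\<^bsub>X\<^esub>)" using diffeo_const[OF is_dvs_diffeo[OF X]] zX by blast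
    then show "plots ?Q n U q"
      using q coset[OF zX]
      by (auto simp: quotient_dvs_def quotient_diffeology_def locally_lifts_def
          intro!: exI[of _ U] exI[of _ "\<lambda>_. \<zero>\<^bsub>X\<^esub>"])
  qed
  have zQ: "\<zero>\<^bsub>?Q\<^esub> = ?K" by (simp add: quotient_dvs_def)
  have Q: "is_dvs ?Q"
  proof (rule is_dvs_zeroI)
    show "\<zero>\<^bsub>?Q\<^esub> \<oplus>\<^bsub>?Q\<^esub> \<zero>\<^bsub>?Q\<^esub> = \<zero>\<^bsub>?Q\<^esub>"
      using add[of ?K ?K] zX by (auto simp: quotient_dvs_def)
    show "a \<odot>\<^bsub>?Q\<^esub> \<zero>\<^bsub>?Q\<^esub> = \<zero>\<^bsub>?Q\<^esub>" for a
      using add[of ?K "(\<lambda>x. a \<odot>\<^bsub>X\<^esub> x) ` ?K"] zX dvs_smult_closed[OF X]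
      by (auto simp: quotient_dvs_def)
  qed (simp_all add: cQ zQ pQ)
  have i: "the_elem (d ` ?K) = \<zero>\<^bsub>Y\<^esub>"
  proof -
    have "d ` ?K = {\<zero>\<^bsub>Y\<^esub>}" using d0 zX by force
    then show ?thesis by simp
  qed
  have "(\<lambda>C. the_elem (d ` C)) \<in> dvs_hom ?Q Y"
  proof (rule dvs_homI)
    fix n U p assume "plots ?Q n U p"
    then show "plots Y n U (\<lambda>u. the_elem (d ` p u))" by (auto simp: pQ zero_dvs_plots[OF Y] i)
  next
    fix x y assume "x \<in> carrier ?Q" "y \<in> carrier ?Q"
    moreover from this have "x \<oplus>\<^bsub>?Q\<^esub> y \<in> carrier ?Q" by (rule dvs_add_closed[OF Q])
    ultimately show "the_elem (d ` (x \<oplus>\<^bsub>?Q\<^esub> y)) = the_elem (d ` x) \<oplus>\<^bsub>Y\<^esub> the_elem (d ` y)"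
      by (simp add: cQ i dvs_simps[OF Y(1)])
  next
    fix a x assume "x \<in> carrier ?Q"
    moreover from this have "a \<odot>\<^bsub>?Q\<^esub> x \<in> carrier ?Q" by (rule dvs_smult_closed[OF Q])
    ultimately show "the_elem (d ` (a \<odot>\<^bsub>?Q\<^esub> x)) = a \<odot>\<^bsub>Y\<^esub> the_elem (d ` x)"
      by (simp add: cQ i dvs_simps[OF Y(1)])
  qed (auto simp: cQ i Y)
  then show ?thesis
    unfolding exact_at_zero[OF Z Y(1) e refl refl] K using Q Y(1)
    by (auto simp: cQ i Y(2) induction_map_def pQ zero_dvs_plots[OF Y])
qed

theorem projective_resolution_complex_iff:
  "projective_resolution_complex V d A \<longleftrightarrow>
     V (- 1) = A \<and> (\<forall>n. n < - 1 \<longrightarrow> is_dvs (V n) \<and> carrier (V n) = {\<zero>\<^bsub>V n\<^esub>}) \<and>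
     (\<forall>n<0. d n \<in> dvs_hom (V n) (V (n - 1))) \<and>
     projective_resolution (\<lambda>n. V (int n)) (\<lambda>n. d (int n)) (d 0) A"
  (is "?L \<longleftrightarrow> ?R")
proof -
  have int_cases': "(\<forall>n. P n) \<longleftrightarrow> (\<forall>n. n < - 1 \<longrightarrow> P n) \<and> P (- 1) \<and> P 0 \<and> (\<forall>n. P (int (Suc n)))" for P :: "int \<Rightarrow> bool"
  proof (intro iffI conjI allI)
    fix n assume P: "(\<forall>n. n < - 1 \<longrightarrow> P n) \<and> P (- 1) \<and> P 0 \<and> (\<forall>n. P (int (Suc n)))"
    have "n = int (Suc (nat n - 1))" if "n > 0" using that by simp
    then consider "n < - 1" | "n = - 1" | "n = 0" | m where "n = int (Suc m)" by fastforce
    then show "P n" using P by cases auto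
  qed auto
  have shift: "int (Suc n) - 1 = int n" "int (Suc n) + 1 = int (Suc (Suc n))" for n by simp_all
  have zero_cond: "exact_at (V 0) (d 0) A (d (- 1)) (V (- 2)) \<longleftrightarrow> exact_at (V 0) (d 0) A (\<lambda>_. ()) zero_dvs"
    if "is_dvs A" "is_dvs (V (- 2))" "carrier (V (- 2)) = {\<zero>\<^bsub>V (- 2)\<^esub>}" "d (- 1) \<in> dvs_hom A (V (- 2))"
  proof -
    have "carrier zero_dvs = {\<zero>\<^bsub>zero_dvs\<^esub>}" by (auto simp: zero_dvs_def)
    moreover have "(\<lambda>_. ()) \<in> dvs_hom A zero_dvs"
      by (rule dvs_homI) (auto simp: zero_dvs_def diffeo_open[OF is_dvs_diffeo[OF that(1)]])
    ultimately show ?thesis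
      using exact_at_zero[OF that(2,3,1,4) refl refl, of "V 0" "d 0"]
        exact_at_zero[OF is_dvs_zero_dvs _ that(1) _ refl refl, of "\<lambda>_. ()" "V 0" "d 0"] by simp
  qed
  show ?thesis
  proof
    assume L: ?L
    then have A: "V (- 1) = A" and dvs: "\<And>n. is_dvs (V n)" and d: "\<And>n. d n \<in> dvs_hom (V n) (V (n - 1))"
      and dd: "\<And>n x. x \<in> carrier (V (n + 1)) \<Longrightarrow> d n (d (n + 1) x) = \<zero>\<^bsub>V (n - 1)\<^esub>"
      and ex: "\<And>n. exact_at (V (n + 1)) (d (n + 1)) (V n) (d n) (V (n - 1))"
      and zero: "\<And>n. n < - 1 \<Longrightarrow> carrier (V n) = {\<zero>\<^bsub>V n\<^esub>}" and pr: "\<And>n. n \<ge> 0 \<Longrightarrow> projective (V n)"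
      unfolding projective_resolution_complex_def exact_complex_def dvs_complex_def by simp_all
    have "projective_resolution (\<lambda>n. V (int n)) (\<lambda>n. d (int n)) (d 0) A"
      unfolding projective_resolution_def
    proof (intro conjI allI ballI)
      show "is_dvs A" using dvs[of "- 1"] A by simp
      show "projective (V (int n))" for n by (simp add: pr)
      show "d 0 \<in> dvs_hom (V (int 0)) A" using d[of 0] A by simp
      show "d (int (Suc n)) \<in> dvs_hom (V (int (Suc n))) (V (int n))" for n
        using d[of "int (Suc n)"] unfolding shift .
      show "d 0 (d (int 1) x) = \<zero>\<^bsub>A\<^esub>" if "x \<in> carrier (V (int 1))" for x
        using dd[of x 0] that A by simp
      show "d (int (Suc n)) (d (int (Suc (Suc n))) x) = \<zero>\<^bsub>V (int n)\<^esub>"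
        if "x \<in> carrier (V (int (Suc (Suc n))))" for n x
        using dd[of x "int (Suc n)"] that unfolding shift by blast
      show "exact_at (V (int 0)) (d 0) A (\<lambda>_. ()) zero_dvs"
        using zero_cond ex[of "- 1"] dvs[of "- 1"] dvs[of "- 2"] zero[of "- 2"] d[of "- 1"] A by simp
      show "exact_at (V (int 1)) (d (int 1)) (V (int 0)) (d 0) A" using ex[of 0] A by simp
      show "exact_at (V (int (Suc (Suc n)))) (d (int (Suc (Suc n)))) (V (int (Suc n))) (d (int (Suc n))) (V (int n))" for n
        using ex[of "int (Suc n)"] unfolding shift .
    qed
    then show ?R using A dvs zero d by blast
  next
    assume R: ?R
    then have A: "V (- 1) = A" and zdvs: "\<And>n. n < - 1 \<Longrightarrow> is_dvs (V n)"
      and zero: "\<And>n. n < - 1 \<Longrightarrow> carrier (V n) = {\<zero>\<^bsub>V n\<^esub>}"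
      and dneg: "\<And>n. n < 0 \<Longrightarrow> d n \<in> dvs_hom (V n) (V (n - 1))" by blast+
    have "projective_resolution (\<lambda>n. V (int n)) (\<lambda>n. d (int n)) (d 0) A" using R by blast
    note P = this[unfolded projective_resolution_def]
    have dA: "is_dvs A" and pr: "\<And>n. projective (V (int n))" and d0: "d 0 \<in> dvs_hom (V 0) A"
      and dpos: "\<And>n. d (int (Suc n)) \<in> dvs_hom (V (int (Suc n))) (V (int n))"
      and dd0: "\<And>x. x \<in> carrier (V 1) \<Longrightarrow> d 0 (d 1 x) = \<zero>\<^bsub>A\<^esub>"
      and dd: "\<And>n x. x \<in> carrier (V (int (Suc (Suc n)))) \<Longrightarrow> d (int (Suc n)) (d (int (Suc (Suc n))) x) = \<zero>\<^bsub>V (int n)\<^esub>"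
      and exA: "exact_at (V 0) (d 0) A (\<lambda>_. ()) zero_dvs"
      and ex0: "exact_at (V 1) (d 1) (V 0) (d 0) A"
      and ex: "\<And>n. exact_at (V (int (Suc (Suc n)))) (d (int (Suc (Suc n)))) (V (int (Suc n))) (d (int (Suc n))) (V (int n))"
      using P unfolding of_nat_0 of_nat_1 by blast+
    have dvs: "\<forall>n. is_dvs (V n)"
      unfolding int_cases'[of "\<lambda>n. is_dvs (V n)"]
      using zdvs dA A pr[of 0] pr[of "Suc _"] by (auto simp: projective_def simp del: of_nat_Suc)
    have d: "\<forall>n. d n \<in> dvs_hom (V n) (V (n - 1))"
      unfolding int_cases'[of "\<lambda>n. d n \<in> dvs_hom (V n) (V (n - 1))"] shift
      using dneg dneg[of "- 1"] dpos d0 A by simp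
    have z: "d n (d (n + 1) x) = \<zero>\<^bsub>V (n - 1)\<^esub>" if "n < 0" "x \<in> carrier (V (n + 1))" for n x
    proof -
      have "d n (d (n + 1) x) \<in> carrier (V (n - 1))"
        using d dvs_hom_in[of "d (n + 1)" "V (n + 1)" "V n" x] dvs_hom_in[of "d n" "V n" "V (n - 1)"] that
        by (metis add_diff_cancel_right')
      then show ?thesis using zero[of "n - 1"] that by simp
    qed
    have dd': "\<forall>n. \<forall>x\<in>carrier (V (n + 1)). d n (d (n + 1) x) = \<zero>\<^bsub>V (n - 1)\<^esub>"
      unfolding int_cases'[of "\<lambda>n. \<forall>x\<in>carrier (V (n + 1)). d n (d (n + 1) x) = \<zero>\<^bsub>V (n - 1)\<^esub>"] shift
      using z z[of "- 1"] dd dd0 A by (intro conjI allI impI ballI) (auto simp: z simp del: of_nat_Suc)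
    have exA': "exact_at (V 0) (d 0) A (d (- 1)) (V (- 2))"
      using zero_cond exA dvs dA zero[of "- 2"] dneg[of "- 1"] A by simp
    have exz: "exact_at (V (n + 1)) (d (n + 1)) (V n) (d n) (V (n - 1))" if "n < - 1" for n
      using that dvs d[rule_format, of "n + 1"] d by (intro exact_at_zero_zero zero) auto
    have "\<forall>n. exact_at (V (n + 1)) (d (n + 1)) (V n) (d n) (V (n - 1))"
      unfolding int_cases'[of "\<lambda>n. exact_at (V (n + 1)) (d (n + 1)) (V n) (d n) (V (n - 1))"] shift
      using exz exA' ex0 ex A by simp
    moreover have "\<forall>n\<ge>0. projective (V n)" using pr by (metis nonneg_int_cases)
    ultimately show ?L
      unfolding projective_resolution_complex_def exact_complex_def dvs_complex_def
      using dvs d dd' A zero by blast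
  qed
qed

end

theory Submission
  imports Defs
begin

text \<open>
  A complex is exact precisely when each differential subducts onto the kernel of the next one, so a
  resolution can be built from one kernel at a time. Given a short exact sequence \<open>A' \<rightarrow> A \<rightarrow> A''\<close> and
  linear subductions \<open>e'\<close>, \<open>e''\<close> from \<open>P'\<close>, \<open>P''\<close> onto its ends, projectivity of \<open>P''\<close> lifts \<open>e''\<close> to
  \<open>h\<close> from \<open>P''\<close> to \<open>A\<close>, and \<open>e (x, y) = i (e' x) + h y\<close> works: given a plot \<open>q\<close> of \<open>A\<close>, lift \<open>p \<circ> q\<close> locally
  to a plot \<open>s\<close> of \<open>P''\<close>; then \<open>q - h \<circ> s\<close> is a plot in the image of the induction \<open>i\<close>, so it lifts
  locally to \<open>P'\<close>. The same argument applied to \<open>- h \<circ> s\<close> for a plot \<open>s\<close> of \<open>ker e''\<close> shows that the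
  kernels again form a short exact sequence, to which the construction is applied next.
\<close>

section \<open>Linear algebra and plots in a diffeological vector space\<close>

lemma dvs_hom_zero:
  assumes "is_dvs V" "is_dvs W" "f \<in> dvs_hom V W"
  shows "f \<zero>\<^bsub>V\<^esub> = \<zero>\<^bsub>W\<^esub>"
  using dvs_hom_smult[OF assms(3) dvs_zero_closed[OF assms(1)], of 0]
    dvs_hom_in[OF assms(3) dvs_zero_closed[OF assms(1)]]
  by (simp add: dvs_simps[OF assms(1)] dvs_simps[OF assms(2)])

text \<open>Differences are written with the scalar \<open>- 1\<close> throughout, so that
  smoothness of addition and scalar multiplication directly makes the difference of two plots a
  plot.\<close>

lemma dvs_smult_minus_one:
  assumes "is_dvs V" "x \<in> carrier V"
  shows "(- 1) \<odot>\<^bsub>V\<^esub> x \<oplus>\<^bsub>V\<^esub> x = \<zero>\<^bsub>V\<^esub>"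
  using dvs_smult_l[OF assms(1), of x "- 1" 1] assms(2) by (simp add: dvs_simps[OF assms(1)])

lemma dvs_add_smult_minus_one:
  assumes V: "is_dvs V" and x: "x \<in> carrier V"
  shows "x \<oplus>\<^bsub>V\<^esub> (- 1) \<odot>\<^bsub>V\<^esub> x = \<zero>\<^bsub>V\<^esub>"
  using dvs_smult_minus_one[OF V x] dvs_comm[OF V x dvs_smult_closed[OF V x]] by simp

lemma dvs_diff_add_cancel:
  assumes V: "is_dvs V" and x: "x \<in> carrier V" and y: "y \<in> carrier V"
  shows "x \<oplus>\<^bsub>V\<^esub> (- 1) \<odot>\<^bsub>V\<^esub> y \<oplus>\<^bsub>V\<^esub> y = x"
  using dvs_smult_minus_one[OF V y] x y by (simp add: dvs_simps[OF V])

lemma dvs_plot_smult_const: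
  assumes V: "is_dvs V" and p: "plots V n U p"
  shows "plots V n U (\<lambda>u. a \<odot>\<^bsub>V\<^esub> p u)"
  using dvs_plot_smult[OF V _ p, of "\<lambda>_. a"] diffeo_open[OF is_dvs_diffeo[OF V], OF p]
  by (simp add: smooth_fun_def C_k_on_const)

lemma dvs_hom_eq_iff_diff_in_kernel:
  assumes V: "is_dvs V" and W: "is_dvs W" and f: "f \<in> dvs_hom V W"
    and x: "x \<in> carrier V" and y: "y \<in> carrier V"
  shows "f (x \<oplus>\<^bsub>V\<^esub> (- 1) \<odot>\<^bsub>V\<^esub> y) = \<zero>\<^bsub>W\<^esub> \<longleftrightarrow> f x = f y"
proof -
  note c = dvs_hom_in[OF f x] dvs_hom_in[OF f y]
  have "f (x \<oplus>\<^bsub>V\<^esub> (- 1) \<odot>\<^bsub>V\<^esub> y) = f x \<oplus>\<^bsub>W\<^esub> (- 1) \<odot>\<^bsub>W\<^esub> f y"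
    using x y by (simp add: dvs_hom_add[OF f] dvs_hom_smult[OF f] dvs_simps[OF V])
  then show ?thesis
    using dvs_diff_add_cancel[OF W c] dvs_add_smult_minus_one[OF W c(1)] c
    by (auto simp: dvs_l_zero[OF W])
qed

lemma mem_a_kernel_iff: "x \<in> a_kernel V W f \<longleftrightarrow> x \<in> carrier V \<and> f x = \<zero>\<^bsub>W\<^esub>"
  by (simp add: a_kernel_def')

lemma a_kernel_sub_dvs [simp]: "a_kernel V (sub_dvs W S) f = a_kernel V W f"
  by (simp add: a_kernel_def')

lemma sub_dvs_carrier:
  assumes "is_dvs V"
  shows "sub_dvs V (carrier V) = V"
proof -
  have "sub_diffeology (carrier V) (plots V) = plots V"
    using diffeo_in[OF is_dvs_diffeo[OF assms]] by (auto simp: sub_diffeology_def fun_eq_iff)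
  then show ?thesis by (simp add: sub_dvs_def)
qed

lemma dvs_hom_into_sub_dvs:
  "f \<in> dvs_hom V (sub_dvs W S) \<longleftrightarrow> f \<in> dvs_hom V W \<and> f \<in> carrier V \<rightarrow> S"
  if "is_dvs V" "S \<subseteq> carrier W"
  using that(2) diffeo_in[OF is_dvs_diffeo[OF that(1)]]
  by (auto simp: dvs_hom_def smooth_map_def sub_diffeology_def Pi_iff)

lemma is_dvs_kernel:
  assumes V: "is_dvs V" and W: "is_dvs W" and f: "f \<in> dvs_hom V W"
  shows "is_dvs (sub_dvs V (a_kernel V W f))"
  by (rule is_dvs_sub_dvs[OF V])
    (auto simp: a_kernel_def' dvs_simps[OF V] dvs_simps[OF W] dvs_hom_zero[OF V W f]
      dvs_hom_add[OF f] dvs_hom_smult[OF f])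

text \<open>Surjectivity follows from local lifting: a point of \<open>Y\<close> is a constant plot
  on the one-point space \<open>Euclidean_space 0\<close>, and any local lift of that plot takes a
  preimage of the point as a value.\<close>

lemma subduction_mapI:
  assumes X: "diffeological_space X DX" and Y: "diffeological_space Y DY"
    and f: "smooth_map X DX Y DY f"
    and lift: "\<And>n U q u. DY n U q \<Longrightarrow> u \<in> U \<Longrightarrow>
      \<exists>V p. openin (Euclidean_space n) V \<and> u \<in> V \<and> V \<subseteq> U \<and> DX n V p \<and> (\<forall>v\<in>V. q v = f (p v))"
  shows "subduction_map X DX Y DY f"
  unfolding subduction_map_def locally_lifts_def
proof (intro conjI allI impI ballI)
  show "f ` X = Y"
  proof
    show "Y \<subseteq> f ` X"
    proof
      fix y assume y: "y \<in> Y"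
      let ?U = "topspace (Euclidean_space 0)"
      have q: "DY 0 ?U (\<lambda>_. y)" by (rule diffeo_const[OF Y, OF _ y]) simp
      have "(\<lambda>_. 0) \<in> ?U" by (simp add: topspace_Euclidean_space)
      from lift[OF q this] obtain V p where "(\<lambda>_. 0) \<in> V" and p: "DX 0 V p" and "\<forall>v\<in>V. y = f (p v)"
        by (elim exE conjE)
      then show "y \<in> f ` X" using diffeo_in[OF X, OF p] by blast
    qed
  qed (use f in \<open>auto simp: smooth_map_def\<close>)
qed (rule f, rule lift)

lemma subduction_dvsI:
  assumes "is_dvs V" "is_dvs W" "f \<in> dvs_hom V W"
    and "\<And>n U q u. plots W n U q \<Longrightarrow> u \<in> U \<Longrightarrow>
      \<exists>U' p. openin (Euclidean_space n) U' \<and> u \<in> U' \<and> U' \<subseteq> U \<and> plots V n U' p \<and> (\<forall>v\<in>U'. q v = f (p v))"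
  shows "subduction V W f"
  by (rule subduction_mapI[OF is_dvs_diffeo[OF assms(1)] is_dvs_diffeo[OF assms(2)] _ assms(4)])
    (use assms(3) in \<open>simp_all add: dvs_hom_def\<close>)

lemma subductionE:
  assumes "subduction_map X DX Y DY f" "DY n U q" "u \<in> U"
  obtains V p where "openin (Euclidean_space n) V" "u \<in> V" "V \<subseteq> U" "DX n V p" "\<And>v. v \<in> V \<Longrightarrow> q v = f (p v)"
  by (rule locally_liftsE[OF subduction_lifts[OF assms(1), OF assms(2)] assms(3)]) (rule that, assumption+, blast)

lemma subduction_surj: "subduction_map X DX Y DY f \<Longrightarrow> f ` X = Y"
  by (simp add: subduction_map_def)


section \<open>Quotients\<close>

text \<open>The partial derivatives in \<open>C_k_on\<close> are taken at single points, so the same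
  functions \<open>g\<close> serve on the smaller set.\<close>

lemma C_k_on_mono: "C_k_on k n U f \<Longrightarrow> V \<subseteq> U \<Longrightarrow> C_k_on k n V f"
proof (induction k arbitrary: f)
  case 0
  then show ?case by (auto intro: continuous_map_from_subtopology_mono)
next
  case (Suc k)
  then have "continuous_map (subtopology (Euclidean_space n) V) euclideanreal f"
    by (auto intro: continuous_map_from_subtopology_mono)
  with Suc show ?case by (fastforce dest: subsetD)
qed

text \<open>Smoothness contains continuity of the coordinates below \<open>n\<close>. The remaining
  coordinates vanish because the values lie in \<open>U\<close>.\<close>

lemma smooth_between_continuous:
  assumes "smooth_between m V n U h"
  shows "continuous_map (subtopology (Euclidean_space m) V) (Euclidean_space n) h"
proof -
  have V: "V \<subseteq> topspace (Euclidean_space m)" and U: "U \<subseteq> topspace (Euclidean_space n)"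
    and h: "\<And>v. v \<in> V \<Longrightarrow> h v \<in> U"
    using assms openin_subset by (auto simp: smooth_between_def)
  have zero: "h v j = 0" if "v \<in> V" "\<not> j < n" for v j
    using h[OF that(1)] U that(2) by (auto simp: topspace_Euclidean_space)
  have "continuous_map (subtopology (Euclidean_space m) V) euclideanreal (\<lambda>x. h x j)" for j
  proof (cases "j < n")
    case True
    then have "smooth_fun m V (\<lambda>x. h x j)" using assms by (simp add: smooth_between_def)
    then have "C_k_on 0 m V (\<lambda>x. h x j)" unfolding smooth_fun_def by blast
    then show ?thesis by simp
  next
    case False
    have "continuous_map (subtopology (Euclidean_space m) V) euclideanreal (\<lambda>x. 0)" by simp
    then show ?thesis by (rule continuous_map_eq) (use V zero False in auto)
  qed
  then show ?thesis
    using V h U zero unfolding Euclidean_space_def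
    by (auto simp: continuous_map_in_subtopology continuous_map_componentwise_UNIV)
qed

text \<open>A local lift is defined only on a neighbourhood \<open>U'\<close>. To pull it back along
  \<open>h\<close>, the domain of \<open>h\<close> has to shrink to the preimage of
  \<open>U'\<close>, which is open by continuity.\<close>

lemma smooth_between_restrict:
  assumes h: "smooth_between m V n U h" and U': "openin (Euclidean_space n) U'"
  defines "V' \<equiv> {v \<in> V. h v \<in> U'}"
  shows "smooth_between m V' n U' h" and "openin (Euclidean_space m) V'"
proof -
  have V: "openin (Euclidean_space m) V" using h by (simp add: smooth_between_def)
  have "V' = {v \<in> topspace (subtopology (Euclidean_space m) V). h v \<in> U'}"
    using openin_subset[OF V] by (auto simp: V'_def)
  then have "openin (subtopology (Euclidean_space m) V) V'"
    using openin_continuous_map_preimage[OF smooth_between_continuous[OF h] U'] by simp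
  then show *: "openin (Euclidean_space m) V'" using V by (simp add: openin_open_subtopology)
  have "V' \<subseteq> V" by (auto simp: V'_def)
  then show "smooth_between m V' n U' h"
    using h U' * by (auto simp: smooth_between_def smooth_fun_def V'_def intro: C_k_on_mono[where U = V])
qed

section \<open>Quotient diffeologies and quotient vector spaces\<close>

text \<open>Constants lift by surjectivity of \<open>f\<close>, and covers are harmless because
  lifting is a local condition. For a composite \<open>q \<circ> h\<close>, a lift \<open>p\<close>
  of \<open>q\<close> near \<open>h v\<close> gives the lift \<open>p \<circ> h\<close> on the
  preimage of the domain of \<open>p\<close>.\<close>

lemma diffeo_quotient:
  assumes X: "diffeological_space X D" and f: "f ` X = Y"
  shows "diffeological_space Y (quotient_diffeology f D)"
  unfolding diffeological_space_def quotient_diffeology_def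
proof (intro conjI allI impI; (elim conjE)?)
  fix n U q assume "locally_lifts f D n U q"
  then have "\<exists>V p. u \<in> V \<and> D n V p \<and> (\<forall>v\<in>V. q v = f (p v))" if "u \<in> U" for u
    using that unfolding locally_lifts_def by blast
  then show "q \<in> U \<rightarrow> Y" using f diffeo_in[OF X] by blast
next
  fix n U p q assume "locally_lifts f D n U p" "\<forall>u\<in>U. q u = p u"
  then show "locally_lifts f D n U q" unfolding locally_lifts_def by (metis subset_iff)
next
  fix n U y assume U: "openin (Euclidean_space n) U" and "y \<in> Y"
  then obtain x where "x \<in> X" "y = f x" using f by blast
  then show "locally_lifts f D n U (\<lambda>u. y)"
    unfolding locally_lifts_def using U diffeo_const[OF X] by blast
next
  fix n U q m V h
  assume q: "locally_lifts f D n U q" and h: "smooth_between m V n U h"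
  then show "openin (Euclidean_space m) V" by (simp add: smooth_between_def)
  show "locally_lifts f D m V (q \<circ> h)"
    unfolding locally_lifts_def
  proof
    fix v assume v: "v \<in> V"
    then have "h v \<in> U" using h by (auto simp: smooth_between_def)
    with q obtain U' p where U': "openin (Euclidean_space n) U'" "h v \<in> U'" and "U' \<subseteq> U"
      and p: "D n U' p" "\<forall>w\<in>U'. q w = f (p w)"
      by (rule locally_liftsE)
    then have "D m {v \<in> V. h v \<in> U'} (p \<circ> h)"
      using diffeo_comp[OF X, OF p(1) smooth_between_restrict(1)[OF h U'(1)]] by simp
    then show "\<exists>V' p. openin (Euclidean_space m) V' \<and> v \<in> V' \<and> V' \<subseteq> V \<and> D m V' p \<and> (\<forall>v\<in>V'. (q \<circ> h) v = f (p v))"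
      using U' p v smooth_between_restrict(2)[OF h U'(1)]
      by (intro exI[of _ "{v \<in> V. h v \<in> U'}"] exI[of _ "p \<circ> h"]) auto
  qed
next
  fix n \<U> q assume "\<forall>U\<in>\<U>. openin (Euclidean_space n) U \<and> locally_lifts f D n U q"
  then show "locally_lifts f D n (\<Union>\<U>) q"
    unfolding locally_lifts_def by (meson UnionE Union_upper subset_trans)
qed (auto simp: openin_Union)

text \<open>Sums and multiples of plots of \<open>Q\<close> are lifted by adding and scaling local
  lifts in \<open>X\<close>. The compatibility of \<open>f\<close> with the operations is assumed as
  equations, since \<open>Q\<close> is not yet known to be a diffeological vector space.\<close>

lemma is_dvs_quotientI:
  assumes X: "is_dvs X" and surj: "f ` carrier X = carrier Q" and zero: "f \<zero>\<^bsub>X\<^esub> = \<zero>\<^bsub>Q\<^esub>"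
    and add: "\<And>x y. x \<in> carrier X \<Longrightarrow> y \<in> carrier X \<Longrightarrow> f x \<oplus>\<^bsub>Q\<^esub> f y = f (x \<oplus>\<^bsub>X\<^esub> y)"
    and smult: "\<And>a x. x \<in> carrier X \<Longrightarrow> a \<odot>\<^bsub>Q\<^esub> f x = f (a \<odot>\<^bsub>X\<^esub> x)"
    and plots: "plots Q = quotient_diffeology f (plots X)"
  shows "is_dvs Q"
proof (rule is_dvsI)
  note D = is_dvs_diffeo[OF X]
  \<comment> \<open>These rules move every operation of \<open>Q\<close> under \<open>f\<close>, so
    each law for \<open>Q\<close> becomes the image of the same law for \<open>X\<close>.\<close>
  note [simp] = dvs_simps[OF X] add smult zero[symmetric]
  show "module real_ring Q"
    by (rule real_moduleI) (auto simp: surj[symmetric] intro!: arg_cong[of _ _ f] intro: dvs_comm[OF X])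
  show "diffeological_space (carrier Q) (plots Q)"
    unfolding plots by (rule diffeo_quotient[OF D surj])
next
  note D = is_dvs_diffeo[OF X]
  fix n U p q assume "plots Q n U p" "plots Q n U q"
  then have U: "openin (Euclidean_space n) U" and pq: "locally_lifts f (plots X) n U p" "locally_lifts f (plots X) n U q"
    by (auto simp: plots quotient_diffeology_def)
  have "\<exists>V r. openin (Euclidean_space n) V \<and> u \<in> V \<and> V \<subseteq> U \<and> plots X n V r \<and> (\<forall>v\<in>V. p v \<oplus>\<^bsub>Q\<^esub> q v = f (r v))"
    if u: "u \<in> U" for u
  proof -
    obtain V1 r1 where 1: "openin (Euclidean_space n) V1" "u \<in> V1" "V1 \<subseteq> U" "plots X n V1 r1" "\<forall>v\<in>V1. p v = f (r1 v)"
      by (rule locally_liftsE[OF pq(1) u])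
    obtain V2 r2 where 2: "openin (Euclidean_space n) V2" "u \<in> V2" "V2 \<subseteq> U" "plots X n V2 r2" "\<forall>v\<in>V2. q v = f (r2 v)"
      by (rule locally_liftsE[OF pq(2) u])
    \<comment> \<open>The two summands lift on different neighbourhoods, so both lifts are
      restricted to the common part before they are added.\<close>
    let ?V = "V1 \<inter> V2"
    have V: "openin (Euclidean_space n) ?V" using 1 2 by blast
    have r: "plots X n ?V r1" "plots X n ?V r2"
      using diffeo_restrict[OF D, OF _ V] 1(4) 2(4) by (meson inf_le1 inf_le2)+
    have "\<forall>v\<in>?V. p v \<oplus>\<^bsub>Q\<^esub> q v = f (r1 v \<oplus>\<^bsub>X\<^esub> r2 v)"
      using 1 2 r by (auto simp: add diffeo_in[OF D])
    then show ?thesis using V 1 2 dvs_plot_add[OF X r] by blast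
  qed
  then show "plots Q n U (\<lambda>u. p u \<oplus>\<^bsub>Q\<^esub> q u)"
    using U by (simp add: plots quotient_diffeology_def locally_lifts_def)
next
  note D = is_dvs_diffeo[OF X]
  fix n U a p assume a: "smooth_fun n U a" and "plots Q n U p"
  then have U: "openin (Euclidean_space n) U" and p: "locally_lifts f (plots X) n U p"
    by (auto simp: plots quotient_diffeology_def)
  have "\<exists>V r. openin (Euclidean_space n) V \<and> u \<in> V \<and> V \<subseteq> U \<and> plots X n V r \<and> (\<forall>v\<in>V. a v \<odot>\<^bsub>Q\<^esub> p v = f (r v))"
    if u: "u \<in> U" for u
  proof -
    obtain V r where r: "openin (Euclidean_space n) V" "u \<in> V" "V \<subseteq> U" "plots X n V r" "\<forall>v\<in>V. p v = f (r v)"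
      by (rule locally_liftsE[OF p u])
    have "smooth_fun n V a" using a r by (auto simp: smooth_fun_def intro: C_k_on_mono[where U = U])
    then have "plots X n V (\<lambda>v. a v \<odot>\<^bsub>X\<^esub> r v)" by (rule dvs_plot_smult[OF X _ r(4)])
    moreover have "\<forall>v\<in>V. a v \<odot>\<^bsub>Q\<^esub> p v = f (a v \<odot>\<^bsub>X\<^esub> r v)"
      using r by (auto simp: smult diffeo_in[OF D])
    ultimately show ?thesis using r by blast
  qed
  then show "plots Q n U (\<lambda>u. a u \<odot>\<^bsub>Q\<^esub> p u)"
    using U by (simp add: plots quotient_diffeology_def locally_lifts_def)
qed

section \<open>The quotient by a kernel and the induced map\<close>

abbreviation kernel_quotient :: "'a dvs \<Rightarrow> 'b dvs \<Rightarrow> ('a \<Rightarrow> 'b) \<Rightarrow> 'a set dvs" where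
  "kernel_quotient V W f \<equiv> quotient_dvs V (a_kernel V W f)"

abbreviation induced_map :: "('a \<Rightarrow> 'b) \<Rightarrow> 'a set \<Rightarrow> 'b" where
  "induced_map f \<equiv> \<lambda>C. the_elem (f ` C)"

context
  fixes X :: "'a dvs" and Y :: "'b dvs" and d
  assumes X: "is_dvs X" and Y: "is_dvs Y" and d: "d \<in> dvs_hom X Y"
begin


text \<open>Two vectors differ by an element of the kernel exactly when \<open>d\<close> agrees on
  them. Describing cosets as fibres of \<open>d\<close> reduces the coset arithmetic below to
  equations in \<open>Y\<close>.\<close>

lemma kernel_coset_eq:
  assumes x: "x \<in> carrier X"
  shows "a_kernel X Y d +>\<^bsub>X\<^esub> x = {y \<in> carrier X. d y = d x}"
proof
  show "a_kernel X Y d +>\<^bsub>X\<^esub> x \<subseteq> {y \<in> carrier X. d y = d x}"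
    using x dvs_hom_in[OF d]
    by (auto simp: a_r_coset_def' a_kernel_def' dvs_simps[OF X] dvs_simps[OF Y] dvs_hom_add[OF d])
  show "{y \<in> carrier X. d y = d x} \<subseteq> a_kernel X Y d +>\<^bsub>X\<^esub> x"
  proof clarify
    fix y assume y: "y \<in> carrier X" "d y = d x"
    then have "y \<oplus>\<^bsub>X\<^esub> (- 1) \<odot>\<^bsub>X\<^esub> x \<in> a_kernel X Y d"
      using x by (simp add: a_kernel_def' dvs_simps[OF X] dvs_hom_eq_iff_diff_in_kernel[OF X Y d])
    then show "y \<in> a_kernel X Y d +>\<^bsub>X\<^esub> x"
      using dvs_diff_add_cancel[OF X y(1) x] unfolding a_r_coset_def' by force
  qed
qed

lemma kernel_coset_add:
  assumes x: "x \<in> carrier X" and y: "y \<in> carrier X"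
  shows "(a_kernel X Y d +>\<^bsub>X\<^esub> x) <+>\<^bsub>X\<^esub> (a_kernel X Y d +>\<^bsub>X\<^esub> y) = a_kernel X Y d +>\<^bsub>X\<^esub> (x \<oplus>\<^bsub>X\<^esub> y)"
proof -
  have "z \<in> (a_kernel X Y d +>\<^bsub>X\<^esub> x) <+>\<^bsub>X\<^esub> (a_kernel X Y d +>\<^bsub>X\<^esub> y)" if z: "z \<in> carrier X" "d z = d (x \<oplus>\<^bsub>X\<^esub> y)" for z
  proof -
    \<comment> \<open>With \<open>y\<close> itself as the summand from the second coset,
      \<open>z - y\<close> is the summand required from the first.\<close>
    let ?w = "z \<oplus>\<^bsub>X\<^esub> (- 1) \<odot>\<^bsub>X\<^esub> y"
    have "d ?w = d (x \<oplus>\<^bsub>X\<^esub> y \<oplus>\<^bsub>X\<^esub> (- 1) \<odot>\<^bsub>X\<^esub> y)"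
      using x y z by (simp add: dvs_hom_add[OF d] dvs_hom_in[OF d] dvs_simps[OF X] dvs_simps[OF Y])
    also have "x \<oplus>\<^bsub>X\<^esub> y \<oplus>\<^bsub>X\<^esub> (- 1) \<odot>\<^bsub>X\<^esub> y = x"
      using x y dvs_add_smult_minus_one[OF X y] by (simp add: dvs_simps[OF X])
    finally have "?w \<in> a_kernel X Y d +>\<^bsub>X\<^esub> x" using x y z by (simp add: kernel_coset_eq dvs_simps[OF X])
    moreover have "y \<in> a_kernel X Y d +>\<^bsub>X\<^esub> y" using y by (simp add: kernel_coset_eq)
    ultimately show ?thesis
      using dvs_diff_add_cancel[OF X z(1) y] unfolding set_add_def' by force
  qed
  then show ?thesis
    using x y by (auto simp: kernel_coset_eq set_add_def' dvs_simps[OF X] dvs_hom_add[OF d])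
qed

lemma kernel_coset_zero: "a_kernel X Y d +>\<^bsub>X\<^esub> \<zero>\<^bsub>X\<^esub> = a_kernel X Y d"
  unfolding kernel_coset_eq[OF dvs_zero_closed[OF X]] by (simp add: dvs_hom_zero[OF X Y d] a_kernel_def')

lemma kernel_coset_smult:
  assumes x: "x \<in> carrier X"
  shows "a_kernel X Y d <+>\<^bsub>X\<^esub> ((\<lambda>x. a \<odot>\<^bsub>X\<^esub> x) ` (a_kernel X Y d +>\<^bsub>X\<^esub> x)) = a_kernel X Y d +>\<^bsub>X\<^esub> (a \<odot>\<^bsub>X\<^esub> x)"
proof
  show "a_kernel X Y d <+>\<^bsub>X\<^esub> ((\<lambda>x. a \<odot>\<^bsub>X\<^esub> x) ` (a_kernel X Y d +>\<^bsub>X\<^esub> x)) \<subseteq> a_kernel X Y d +>\<^bsub>X\<^esub> (a \<odot>\<^bsub>X\<^esub> x)"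
    using x dvs_hom_in[OF d]
    by (auto simp: kernel_coset_eq dvs_simps[OF X] dvs_simps[OF Y] set_add_def' mem_a_kernel_iff
        dvs_hom_add[OF d] dvs_hom_smult[OF d])
  \<comment> \<open>An element of the right-hand coset is a kernel element plus \<open>a\<close>
    times \<open>x\<close>; with \<open>x\<close> as representative it lies in the left-hand sum as
    it stands.\<close>
  have "x \<in> a_kernel X Y d +>\<^bsub>X\<^esub> x" using x by (simp add: kernel_coset_eq)
  then show "a_kernel X Y d +>\<^bsub>X\<^esub> (a \<odot>\<^bsub>X\<^esub> x) \<subseteq> a_kernel X Y d <+>\<^bsub>X\<^esub> ((\<lambda>x. a \<odot>\<^bsub>X\<^esub> x) ` (a_kernel X Y d +>\<^bsub>X\<^esub> x))"
    unfolding set_add_def' a_r_coset_def'[of _ _ "a \<odot>\<^bsub>X\<^esub> x"] by blast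
qed

lemma carrier_kernel_quotient: "carrier (kernel_quotient X Y d) = (\<lambda>x. a_kernel X Y d +>\<^bsub>X\<^esub> x) ` carrier X"
  by (auto simp: quotient_dvs_def A_RCOSETS_def')

lemma is_dvs_kernel_quotient: "is_dvs (kernel_quotient X Y d)"
proof (rule is_dvs_quotientI[OF X carrier_kernel_quotient[symmetric]])
qed (simp_all add: quotient_dvs_def kernel_coset_zero kernel_coset_add kernel_coset_smult)

lemma induced_coset:
  assumes "x \<in> carrier X"
  shows "induced_map d (a_kernel X Y d +>\<^bsub>X\<^esub> x) = d x"
proof -
  have "d ` (a_kernel X Y d +>\<^bsub>X\<^esub> x) = {d x}" using assms by (auto simp: kernel_coset_eq)
  then show ?thesis by simp
qed

text \<open>A plot of the quotient is locally the coset of a plot \<open>p\<close> of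
  \<open>X\<close>, so its image is locally \<open>d \<circ> p\<close>. These local plots glue to a
  plot of \<open>Y\<close>.\<close>

lemma induced_hom: "induced_map d \<in> dvs_hom (kernel_quotient X Y d) Y"
proof (rule dvs_homI)
  fix n U q assume q: "plots (kernel_quotient X Y d) n U q"
  have q': "locally_lifts (\<lambda>x. a_kernel X Y d +>\<^bsub>X\<^esub> x) (plots X) n U q"
    using q by (simp add: quotient_dvs_def quotient_diffeology_def)
  show "plots Y n U (\<lambda>u. induced_map d (q u))"
  proof (rule diffeo_local[OF is_dvs_diffeo[OF Y]])
    fix u assume u: "u \<in> U"
    obtain V p where "openin (Euclidean_space n) V" and V: "u \<in> V" "V \<subseteq> U"
      and p: "plots X n V p" "\<forall>v\<in>V. q v = a_kernel X Y d +>\<^bsub>X\<^esub> p v"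
      by (rule locally_liftsE[OF q' u])
    have "plots Y n V (\<lambda>u. induced_map d (q u))"
      by (rule diffeo_cong[OF is_dvs_diffeo[OF Y], OF dvs_hom_plot[OF d p(1)]])
        (use p diffeo_in[OF is_dvs_diffeo[OF X], OF p(1)] induced_coset in auto)
    then show "\<exists>V. u \<in> V \<and> V \<subseteq> U \<and> plots Y n V (\<lambda>u. induced_map d (q u))" using V by blast
  qed
qed (auto simp: carrier_kernel_quotient induced_coset dvs_hom_in[OF d], auto simp: quotient_dvs_def
    kernel_coset_add kernel_coset_smult induced_coset dvs_simps[OF X] dvs_hom_add[OF d] dvs_hom_smult[OF d])

lemma inj_on_induced: "inj_on (induced_map d) (carrier (kernel_quotient X Y d))"
  by (auto simp: inj_on_def carrier_kernel_quotient induced_coset) (auto simp: kernel_coset_eq)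

lemma induced_image: "induced_map d ` carrier (kernel_quotient X Y d) = d ` carrier X"
  by (auto simp: carrier_kernel_quotient induced_coset image_image)

text \<open>Plots of the quotient are the maps that lift locally to \<open>X\<close>. Since the
  induced map is a bijection onto \<open>S\<close>, detecting plots of the quotient through their
  images in \<open>Y\<close> amounts to lifting the plots of \<open>S\<close> locally along
  \<open>d\<close>.\<close>

lemma induction_induced_iff:
  assumes im: "d ` carrier X = S"
  shows "induction (kernel_quotient X Y d) Y (induced_map d) \<longleftrightarrow> subduction X (sub_dvs Y S) d"
proof
  note DX = is_dvs_diffeo[OF X] and DY = is_dvs_diffeo[OF Y]
  have S: "S \<subseteq> carrier Y" using im dvs_hom_in[OF d] by auto
  assume ind: "induction (kernel_quotient X Y d) Y (induced_map d)"
  have "locally_lifts d (plots X) n U q" if q: "plots Y n U q" "q \<in> U \<rightarrow> S" for n U q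
    unfolding locally_lifts_def
  proof
    fix u assume u: "u \<in> U"
    \<comment> \<open>The only factorisation of \<open>q\<close> through the induced map. The chosen
      preimages in \<open>X\<close> need not vary smoothly, but their cosets form a plot by
      \<open>ind\<close>.\<close>
    define r where "r = (\<lambda>u. a_kernel X Y d +>\<^bsub>X\<^esub> (inv_into (carrier X) d (q u)))"
    have r: "r v \<in> carrier (kernel_quotient X Y d)" "induced_map d (r v) = q v" if "v \<in> U" for v
      using q that im[symmetric]
      by (auto simp: r_def carrier_kernel_quotient induced_coset inv_into_into f_inv_into_f Pi_iff)
    have "plots Y n U (induced_map d \<circ> r)"
      by (rule diffeo_cong[OF DY, OF q(1)]) (simp add: r)
    then have "plots (kernel_quotient X Y d) n U r"
      using ind r diffeo_open[OF DY, OF q(1)] unfolding induction_map_def by blast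
    then have "locally_lifts (\<lambda>x. a_kernel X Y d +>\<^bsub>X\<^esub> x) (plots X) n U r"
      by (simp add: quotient_dvs_def quotient_diffeology_def)
    then obtain V p where V: "openin (Euclidean_space n) V" "u \<in> V" "V \<subseteq> U" and p: "plots X n V p" "\<forall>v\<in>V. r v = a_kernel X Y d +>\<^bsub>X\<^esub> p v"
      using u by (rule locally_liftsE)
    have "\<forall>v\<in>V. q v = d (p v)"
      using p(2) r(2) induced_coset[OF diffeo_in[OF DX, OF p(1)]] V(3) by (metis subsetD)
    then show "\<exists>V p. openin (Euclidean_space n) V \<and> u \<in> V \<and> V \<subseteq> U \<and> plots X n V p \<and> (\<forall>v\<in>V. q v = d (p v))"
      using V p by blast
  qed
  moreover have "d \<in> dvs_hom X (sub_dvs Y S)"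
    using im S d by (auto simp: dvs_hom_into_sub_dvs[OF X])
  ultimately show "subduction X (sub_dvs Y S) d"
    using im by (auto simp: subduction_map_def dvs_hom_def sub_diffeology_def)
next
  note DX = is_dvs_diffeo[OF X] and DY = is_dvs_diffeo[OF Y]
  assume sub: "subduction X (sub_dvs Y S) d"
  have "plots (kernel_quotient X Y d) n U q" if q: "q \<in> U \<rightarrow> carrier (kernel_quotient X Y d)" "plots Y n U (induced_map d \<circ> q)" for n U q
  proof -
    have iq: "plots (sub_dvs Y S) n U (induced_map d \<circ> q)"
      using q induced_image im by (auto simp: sub_diffeology_def Pi_iff)
    have "locally_lifts (\<lambda>x. a_kernel X Y d +>\<^bsub>X\<^esub> x) (plots X) n U q"
      unfolding locally_lifts_def
    proof
      fix u assume u: "u \<in> U"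
      obtain V p where V: "openin (Euclidean_space n) V" "u \<in> V" "V \<subseteq> U" and p: "plots X n V p"
        "\<And>v. v \<in> V \<Longrightarrow> (induced_map d \<circ> q) v = d (p v)"
        by (rule subductionE[OF sub, OF iq u]) (rule that, assumption+)
      \<comment> \<open>The lift only gives equality after applying the induced map; injectivity
        turns this into equality of cosets.\<close>
      have "q v = a_kernel X Y d +>\<^bsub>X\<^esub> p v" if v: "v \<in> V" for v
      proof (rule inj_onD[OF inj_on_induced])
        have c: "p v \<in> carrier X" by (rule diffeo_in[OF DX, OF p(1) v])
        show "induced_map d (q v) = induced_map d (a_kernel X Y d +>\<^bsub>X\<^esub> p v)" using p(2)[OF v] induced_coset[OF c] by simp
        show "q v \<in> carrier (kernel_quotient X Y d)" using q v V by auto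
        show "a_kernel X Y d +>\<^bsub>X\<^esub> p v \<in> carrier (kernel_quotient X Y d)" using c by (simp add: carrier_kernel_quotient)
      qed
      then show "\<exists>V p. openin (Euclidean_space n) V \<and> u \<in> V \<and> V \<subseteq> U \<and> plots X n V p \<and> (\<forall>v\<in>V. q v = a_kernel X Y d +>\<^bsub>X\<^esub> p v)"
        using V p by blast
    qed
    then show ?thesis
      using diffeo_open[OF DY, OF q(2)] by (simp add: quotient_dvs_def quotient_diffeology_def)
  qed
  then show "induction (kernel_quotient X Y d) Y (induced_map d)"
    using induced_hom inj_on_induced by (auto simp: induction_map_def dvs_hom_def smooth_map_def)
qed

end

section \<open>Exactness in terms of subductions\<close>

text \<open>Smoothness, linearity and injectivity of the induced map are automatic, and
  \<open>e\<close> always maps onto its image. What remains of \<open>short_exact\<close> is the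
  equality of image and kernel with the induction, which merge into the first subduction, and the
  subduction property of \<open>e\<close>.\<close>

lemma exact_at_iff:
  assumes X: "is_dvs X" and Y: "is_dvs Y" and Z: "is_dvs Z"
    and d: "d \<in> dvs_hom X Y" and e: "e \<in> dvs_hom Y Z"
  shows "exact_at X d Y e Z \<longleftrightarrow>
    subduction X (sub_dvs Y (a_kernel Y Z e)) d \<and> subduction Y (sub_dvs Z (e ` carrier Y)) e"
proof -
  have S: "e ` carrier Y \<subseteq> carrier Z" using dvs_hom_in[OF e] by auto
  have "is_dvs (sub_dvs Z (e ` carrier Y))"
  proof (rule is_dvs_sub_dvs[OF Z S])
    show "\<zero>\<^bsub>Z\<^esub> \<in> e ` carrier Y"
      using dvs_hom_zero[OF Y Z e] dvs_zero_closed[OF Y] by (metis imageI)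
    fix x y assume "x \<in> e ` carrier Y" "y \<in> e ` carrier Y"
    then show "x \<oplus>\<^bsub>Z\<^esub> y \<in> e ` carrier Y"
      using dvs_hom_add[OF e] dvs_add_closed[OF Y] by (auto simp: image_iff) metis
  next
    fix a x assume "x \<in> e ` carrier Y"
    then show "a \<odot>\<^bsub>Z\<^esub> x \<in> e ` carrier Y"
      using dvs_hom_smult[OF e] dvs_smult_closed[OF Y] by (auto simp: image_iff) metis
  qed
  moreover have "e \<in> dvs_hom Y (sub_dvs Z (e ` carrier Y))"
    using e S by (auto simp: dvs_hom_into_sub_dvs[OF Y])
  moreover have "a_kernel Y Z e \<subseteq> carrier Y" by (auto simp: a_kernel_def')
  \<comment> \<open>A subduction onto the kernel forces the image of \<open>d\<close> to be the
    kernel, so \<open>induction_induced_iff\<close> applies in both directions.\<close>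
  then have "d ` carrier X = a_kernel Y Z e \<and> induction (kernel_quotient X Y d) Y (induced_map d)
    \<longleftrightarrow> subduction X (sub_dvs Y (a_kernel Y Z e)) d"
    using induction_induced_iff[OF X Y d] subduction_surj[of "carrier X" "plots X" "carrier (sub_dvs Y (a_kernel Y Z e))"]
    by (metis sub_dvs_simps(1))
  ultimately show ?thesis
    using Y is_dvs_kernel_quotient[OF X Y d] induced_hom[OF X Y d] inj_on_induced[OF X Y d] induced_image[OF X Y d]
    unfolding exact_at_def short_exact_def by auto
qed

section \<open>Resolutions as chains of subductions onto kernels\<close>

text \<open>The case distinction is forced by the augmentation: the map leaving degree
  \<open>0\<close> ends in \<open>A\<close>, whose element type may differ from that of the
  \<open>P n\<close>.\<close>

definition resolution_kernel ::
    "(nat \<Rightarrow> 'p dvs) \<Rightarrow> (nat \<Rightarrow> 'p \<Rightarrow> 'p) \<Rightarrow> ('p \<Rightarrow> 'a) \<Rightarrow> 'a dvs \<Rightarrow> nat \<Rightarrow> 'p set" where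
  "resolution_kernel P d \<epsilon> A n =
     (case n of 0 \<Rightarrow> a_kernel (P 0) A \<epsilon> | Suc m \<Rightarrow> a_kernel (P (Suc m)) (P m) (d (Suc m)))"

lemma resolution_kernel_simps [simp]:
  "resolution_kernel P d \<epsilon> A 0 = a_kernel (P 0) A \<epsilon>"
  "resolution_kernel P d \<epsilon> A (Suc m) = a_kernel (P (Suc m)) (P m) (d (Suc m))"
  by (simp_all add: resolution_kernel_def)

text \<open>Exactness at each spot splits into two subductions by \<open>exact_at_iff\<close>. A map
  that subducts onto the next kernel has this kernel as image, so it also subducts onto its image;
  one subduction per map therefore suffices and forces consecutive maps to compose to zero.\<close>

lemma projective_resolution_iff:
  "projective_resolution P d \<epsilon> A \<longleftrightarrow>
     is_dvs A \<and> (\<forall>n. projective (P n)) \<and> \<epsilon> \<in> dvs_hom (P 0) A \<and>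
     (\<forall>n. d (Suc n) \<in> dvs_hom (P (Suc n)) (P n)) \<and> subduction (P 0) A \<epsilon> \<and>
     (\<forall>n. subduction (P (Suc n)) (sub_dvs (P n) (resolution_kernel P d \<epsilon> A n)) (d (Suc n)))"
  (is "_ \<longleftrightarrow> ?R")
proof (cases "is_dvs A \<and> (\<forall>n. projective (P n)) \<and> \<epsilon> \<in> dvs_hom (P 0) A \<and>
    (\<forall>n. d (Suc n) \<in> dvs_hom (P (Suc n)) (P n))")
  case False
  then show ?thesis by (auto simp: projective_resolution_def)
next
  case True
  then have A: "is_dvs A" and P: "\<And>n. is_dvs (P n)" and \<epsilon>: "\<epsilon> \<in> dvs_hom (P 0) A"
    and d: "\<And>n. d (Suc n) \<in> dvs_hom (P (Suc n)) (P n)"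
    by (auto simp: projective_def)
  note d1 = d[of 0, folded One_nat_def]
  let ?N = "resolution_kernel P d \<epsilon> A"
  have z: "(\<lambda>_. ()) \<in> dvs_hom A zero_dvs" "a_kernel A zero_dvs (\<lambda>_. ()) = carrier A"
    by (rule dvs_homI) (auto simp: zero_dvs_def a_kernel_def' diffeo_open[OF is_dvs_diffeo[OF A]])
  \<comment> \<open>The half of exactness at \<open>A\<close> that concerns the map to zero always
    holds: plots of the zero space lift to the constant plot at the zero of
    \<open>A\<close>.\<close>
  have zsub: "subduction A (sub_dvs zero_dvs ((\<lambda>_. ()) ` carrier A)) (\<lambda>_. ())"
  proof -
    have c: "(\<lambda>_. ()) ` carrier A = carrier zero_dvs" using dvs_zero_closed[OF A] by (auto simp: zero_dvs_def)
    have "subduction A zero_dvs (\<lambda>_. ())"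
    proof (rule subduction_dvsI[OF A is_dvs_zero_dvs z(1)])
      fix n U q and u :: "nat \<Rightarrow> real" assume "plots zero_dvs n U q" "u \<in> U"
      then show "\<exists>V p. openin (Euclidean_space n) V \<and> u \<in> V \<and> V \<subseteq> U \<and> plots A n V p \<and> (\<forall>v\<in>V. q v = ())"
        using diffeo_const[OF is_dvs_diffeo[OF A], OF _ dvs_zero_closed[OF A]] by (auto simp: zero_dvs_def)
    qed
    then show ?thesis unfolding c sub_dvs_carrier[OF is_dvs_zero_dvs] .
  qed
  have exA: "exact_at (P 0) \<epsilon> A (\<lambda>_. ()) zero_dvs \<longleftrightarrow> subduction (P 0) A \<epsilon>"
    unfolding exact_at_iff[OF P A is_dvs_zero_dvs \<epsilon> z(1)] z(2) sub_dvs_carrier[OF A] using zsub by blast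
  have im: "e ` carrier V = N" if "subduction V (sub_dvs W N) e" for e :: "'x \<Rightarrow> 'y" and V W N
    using subduction_surj[OF that] by simp
  have \<epsilon>_sub: "subduction (P 0) (sub_dvs A (\<epsilon> ` carrier (P 0))) \<epsilon>" if "subduction (P 0) A \<epsilon>"
    using that subduction_surj[OF that] by (simp add: sub_dvs_carrier A)
  \<comment> \<open>This supplies the second half of exactness at \<open>P (Suc n)\<close> from the
    subduction onto the kernel one degree lower.\<close>
  have d_sub: "subduction (P (Suc n)) (sub_dvs (P n) (d (Suc n) ` carrier (P (Suc n)))) (d (Suc n))"
    if "subduction (P (Suc n)) (sub_dvs (P n) (?N n)) (d (Suc n))" for n
    using that im[OF that] by simp
  note ex0 = exact_at_iff[OF P P A d1 \<epsilon>] and ex = exact_at_iff[OF P P P d d]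
  show ?thesis
  proof
    assume "projective_resolution P d \<epsilon> A"
    then have s: "subduction (P 0) A \<epsilon>" "exact_at (P 1) (d 1) (P 0) \<epsilon> A"
      "exact_at (P (Suc (Suc n))) (d (Suc (Suc n))) (P (Suc n)) (d (Suc n)) (P n)" for n
      unfolding projective_resolution_def exA by blast+
    have "subduction (P (Suc n)) (sub_dvs (P n) (?N n)) (d (Suc n))" for n
      using s(2)[unfolded ex0] s(3)[unfolded ex] by (cases n) simp_all
    then show ?R using True s(1) by blast
  next
    assume R: ?R
    then have s: "subduction (P 0) A \<epsilon>"
      "\<And>n. subduction (P (Suc n)) (sub_dvs (P n) (?N n)) (d (Suc n))" by blast+
    have k: "d (Suc n) x \<in> ?N n" if "x \<in> carrier (P (Suc n))" for n x
      using im[OF s(2)] that by blast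
    have "\<epsilon> (d 1 x) = \<zero>\<^bsub>A\<^esub>" if "x \<in> carrier (P 1)" for x
      using k[of x 0] that by (simp add: a_kernel_def')
    moreover have "d (Suc n) (d (Suc (Suc n)) x) = \<zero>\<^bsub>P n\<^esub>" if "x \<in> carrier (P (Suc (Suc n)))" for n x
      using k[of x "Suc n"] that by (simp add: a_kernel_def')
    moreover have "exact_at (P 1) (d 1) (P 0) \<epsilon> A"
      unfolding ex0 using s(2)[of 0] \<epsilon>_sub[OF s(1)] by simp
    moreover have "exact_at (P (Suc (Suc n))) (d (Suc (Suc n))) (P (Suc n)) (d (Suc n)) (P n)" for n
      unfolding ex using s(2)[of "Suc n"] d_sub[OF s(2), of n] by simp
    ultimately show "projective_resolution P d \<epsilon> A"
      using True s(1) unfolding projective_resolution_def exA by blast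
  qed
qed


section \<open>Direct sums\<close>

text \<open>This is the coproduct property of the direct sum; smoothness comes from that of addition
  in \<open>E\<close>.\<close>

lemma dvs_hom_copair:
  assumes V: "is_dvs V" and W: "is_dvs W" and E: "is_dvs E"
    and f: "f \<in> dvs_hom V E" and g: "g \<in> dvs_hom W E"
  shows "(\<lambda>(x, y). f x \<oplus>\<^bsub>E\<^esub> g y) \<in> dvs_hom (V \<oplus>\<^sub>D W) E"
proof (rule dvs_homI)
  fix n U p assume "plots (V \<oplus>\<^sub>D W) n U p"
  then have "plots V n U (\<lambda>u. fst (p u))" "plots W n U (\<lambda>u. snd (p u))"
    by (simp_all add: prod_diffeology_def o_def)
  then show "plots E n U (\<lambda>u. case p u of (x, y) \<Rightarrow> f x \<oplus>\<^bsub>E\<^esub> g y)"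
    unfolding split_beta by (intro dvs_plot_add[OF E] dvs_hom_plot[OF f] dvs_hom_plot[OF g])
next
  fix x y assume "x \<in> carrier (V \<oplus>\<^sub>D W)" "y \<in> carrier (V \<oplus>\<^sub>D W)"
  then have c: "f (fst x) \<in> carrier E" "f (fst y) \<in> carrier E" "g (snd x) \<in> carrier E" "g (snd y) \<in> carrier E"
    and "fst x \<in> carrier V" "fst y \<in> carrier V" "snd x \<in> carrier W" "snd y \<in> carrier W"
    using dvs_hom_in[OF f] dvs_hom_in[OF g] by auto
  moreover have "f (fst y) \<oplus>\<^bsub>E\<^esub> (g (snd x) \<oplus>\<^bsub>E\<^esub> g (snd y)) = g (snd x) \<oplus>\<^bsub>E\<^esub> (f (fst y) \<oplus>\<^bsub>E\<^esub> g (snd y))"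
    using c by (metis dvs_assoc[OF E] dvs_comm[OF E])
  ultimately show "(case x \<oplus>\<^bsub>V \<oplus>\<^sub>D W\<^esub> y of (x, y) \<Rightarrow> f x \<oplus>\<^bsub>E\<^esub> g y) =
      (case x of (x, y) \<Rightarrow> f x \<oplus>\<^bsub>E\<^esub> g y) \<oplus>\<^bsub>E\<^esub> (case y of (x, y) \<Rightarrow> f x \<oplus>\<^bsub>E\<^esub> g y)"
    by (simp add: split_beta dvs_hom_add[OF f] dvs_hom_add[OF g] dvs_simps[OF E])
qed (auto simp: dvs_simps[OF E] dvs_hom_in[OF f] dvs_hom_in[OF g] dvs_hom_smult[OF f] dvs_hom_smult[OF g])

lemma dvs_hom_inl: "is_dvs V \<Longrightarrow> is_dvs W \<Longrightarrow> (\<lambda>x. (x, \<zero>\<^bsub>W\<^esub>)) \<in> dvs_hom V (V \<oplus>\<^sub>D W)"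
  by (rule dvs_homI) (auto simp: prod_diffeology_def o_def dvs_simps dvs_zero_closed
      diffeo_const[OF is_dvs_diffeo] diffeo_open[OF is_dvs_diffeo])

lemma dvs_hom_inr: "is_dvs V \<Longrightarrow> is_dvs W \<Longrightarrow> (\<lambda>y. (\<zero>\<^bsub>V\<^esub>, y)) \<in> dvs_hom W (V \<oplus>\<^sub>D W)"
  by (rule dvs_homI) (auto simp: prod_diffeology_def o_def dvs_simps dvs_zero_closed
      diffeo_const[OF is_dvs_diffeo] diffeo_open[OF is_dvs_diffeo])

text \<open>Lifts on the two summands are added. The test spaces here live over the pair type, so
  the lifts for \<open>V\<close> and \<open>W\<close> come from \<open>projective_lift\<close>,
  which allows arbitrary element types.\<close>

lemma projective_direct_sum:
  assumes V: "projective V" and W: "projective W"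
  shows "projective (V \<oplus>\<^sub>D W)"
  unfolding projective_def
proof (intro conjI allI impI)
  have dV: "is_dvs V" and dW: "is_dvs W" using V W by (auto simp: projective_def)
  show "is_dvs (V \<oplus>\<^sub>D W)" by (rule is_dvs_direct_sum[OF dV dW])
  fix W1 W2 :: "('a \<times> 'b) test dvs" and f g
  assume W12: "is_dvs W1" "is_dvs W2" and f: "f \<in> dvs_hom W1 W2" "subduction W1 W2 f"
    and g: "g \<in> dvs_hom (V \<oplus>\<^sub>D W) W2"
  obtain h1 where h1: "h1 \<in> dvs_hom V W1" "\<forall>x\<in>carrier V. g (x, \<zero>\<^bsub>W\<^esub>) = f (h1 x)"
    using projective_lift[OF V W12(1) f dvs_hom_comp[OF dvs_hom_inl[OF dV dW] g] W12(2)] by auto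
  obtain h2 where h2: "h2 \<in> dvs_hom W W1" "\<forall>x\<in>carrier W. g (\<zero>\<^bsub>V\<^esub>, x) = f (h2 x)"
    using projective_lift[OF W W12(1) f dvs_hom_comp[OF dvs_hom_inr[OF dV dW] g] W12(2)] by auto
  have "g (x, y) = f (h1 x \<oplus>\<^bsub>W1\<^esub> h2 y)" if "x \<in> carrier V" "y \<in> carrier W" for x y
    using that dvs_hom_add[OF g, of "(x, \<zero>\<^bsub>W\<^esub>)" "(\<zero>\<^bsub>V\<^esub>, y)"] h1 h2
    by (simp add: dvs_simps[OF dV] dvs_simps[OF dW] dvs_hom_add[OF f(1)] dvs_hom_in[OF h1(1)] dvs_hom_in[OF h2(1)])
  then show "\<exists>h\<in>dvs_hom (V \<oplus>\<^sub>D W) W1. \<forall>x\<in>carrier (V \<oplus>\<^sub>D W). g x = f (h x)"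
    by (intro bexI[OF _ dvs_hom_copair[OF dV dW W12(1) h1(1) h2(1)]]) auto
qed

section \<open>Split sequences and their subsequences\<close>

text \<open>Serves for both the full direct sum and the kernels of the horseshoe step. The inclusion
  is an induction because its second component is constant. The condition \<open>lift\<close>
  supplies the first component of a local lift along \<open>snd\<close>.\<close>

lemma short_exact_direct_sum_sub:
  assumes V: "is_dvs V" and W: "is_dvs W"
    and K': "is_dvs (sub_dvs V K')" "K' \<subseteq> carrier V" and K: "is_dvs (sub_dvs (V \<oplus>\<^sub>D W) K)" "K \<subseteq> carrier (V \<oplus>\<^sub>D W)"
    and K'': "is_dvs (sub_dvs W K'')" "K'' \<subseteq> carrier W"
    and inl: "\<And>x. x \<in> carrier V \<Longrightarrow> (x, \<zero>\<^bsub>W\<^esub>) \<in> K \<longleftrightarrow> x \<in> K'"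
    and snd: "\<And>y. y \<in> K \<Longrightarrow> snd y \<in> K''"
    and lift: "\<And>n U q u. plots W n U q \<Longrightarrow> q \<in> U \<rightarrow> K'' \<Longrightarrow> u \<in> U \<Longrightarrow>
      \<exists>U' p. openin (Euclidean_space n) U' \<and> u \<in> U' \<and> U' \<subseteq> U \<and> plots V n U' p \<and> (\<forall>v\<in>U'. (p v, q v) \<in> K)"
  shows "short_exact (sub_dvs V K') (\<lambda>x. (x, \<zero>\<^bsub>W\<^esub>)) (sub_dvs (V \<oplus>\<^sub>D W) K) snd (sub_dvs W K'')"
proof -
  note D = is_dvs_diffeo[OF V] is_dvs_diffeo[OF W]
  let ?E = "sub_dvs (V \<oplus>\<^sub>D W) K"
  have z: "plots W n U (\<lambda>_. \<zero>\<^bsub>W\<^esub>)" if "openin (Euclidean_space n) U" for n U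
    using that by (rule diffeo_const[OF D(2)]) (rule dvs_zero_closed[OF W])
  have inl_hom: "(\<lambda>x. (x, \<zero>\<^bsub>W\<^esub>)) \<in> dvs_hom (sub_dvs V K') ?E"
    using K'(2) inl z diffeo_open[OF D(1)]
    by (intro dvs_homI) (auto simp: sub_diffeology_def prod_diffeology_def o_def Pi_iff dvs_simps[OF W] subset_iff)
  have snd_hom: "snd \<in> dvs_hom ?E (sub_dvs W K'')"
    using snd by (intro dvs_homI) (auto simp: sub_diffeology_def prod_diffeology_def o_def Pi_iff)
  have ind: "induction (sub_dvs V K') ?E (\<lambda>x. (x, \<zero>\<^bsub>W\<^esub>))"
    using inl K'(2) z
    by (auto simp: induction_map_def sub_diffeology_def prod_diffeology_def o_def Pi_iff inj_on_def subset_iff)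
  have sub: "subduction ?E (sub_dvs W K'') snd"
  proof (rule subduction_dvsI[OF K(1) K''(1) snd_hom])
    fix n U q and u :: "nat \<Rightarrow> real" assume "plots (sub_dvs W K'') n U q" and u: "u \<in> U"
    then have q: "plots W n U q" "q \<in> U \<rightarrow> K''" by (auto simp: sub_diffeology_def)
    from lift[OF q u] obtain U' p where U': "openin (Euclidean_space n) U'" "u \<in> U'" "U' \<subseteq> U"
      and p: "plots V n U' p" "\<forall>v\<in>U'. (p v, q v) \<in> K" by blast
    have "plots ?E n U' (\<lambda>v. (p v, q v))"
      using p diffeo_restrict[OF D(2), OF q(1) U'(1,3)] by (auto simp: sub_diffeology_def prod_diffeology_def o_def)
    then show "\<exists>U' p. openin (Euclidean_space n) U' \<and> u \<in> U' \<and> U' \<subseteq> U \<and> plots ?E n U' p \<and> (\<forall>v\<in>U'. q v = snd (p v))"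
      using U' by (intro exI[of _ U'] exI[of _ "\<lambda>v. (p v, q v)"]) simp
  qed
  have "(\<lambda>x. (x, \<zero>\<^bsub>W\<^esub>)) ` K' = a_kernel ?E (sub_dvs W K'') snd"
    using inl K(2) K'(2) by (force simp: a_kernel_def')
  then show ?thesis
    using K' K K'' inl_hom snd_hom ind sub subduction_surj[OF sub]
    unfolding short_exact_def by (simp add: inj_on_def)
qed

lemma short_exact_direct_sum:
  assumes V: "is_dvs V" and W: "is_dvs W"
  shows "short_exact V (\<lambda>x. (x, \<zero>\<^bsub>W\<^esub>)) (V \<oplus>\<^sub>D W) snd W"
proof -
  note E = is_dvs_direct_sum[OF V W]
  have "short_exact (sub_dvs V (carrier V)) (\<lambda>x. (x, \<zero>\<^bsub>W\<^esub>))
    (sub_dvs (V \<oplus>\<^sub>D W) (carrier (V \<oplus>\<^sub>D W))) snd (sub_dvs W (carrier W))"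
  proof (rule short_exact_direct_sum_sub[OF V W])
    fix n U q and u :: "nat \<Rightarrow> real" assume q: "plots W n U q" "q \<in> U \<rightarrow> carrier W" "u \<in> U"
    then have "openin (Euclidean_space n) U" using diffeo_open[OF is_dvs_diffeo[OF W]] by blast
    then show "\<exists>U' p. openin (Euclidean_space n) U' \<and> u \<in> U' \<and> U' \<subseteq> U \<and> plots V n U' p \<and>
        (\<forall>v\<in>U'. (p v, q v) \<in> carrier (V \<oplus>\<^sub>D W))"
      using q diffeo_const[OF is_dvs_diffeo[OF V], OF _ dvs_zero_closed[OF V]] dvs_zero_closed[OF V]
      by (intro exI[of _ U] exI[of _ "\<lambda>_. \<zero>\<^bsub>V\<^esub>"]) auto
  qed (use V W E dvs_zero_closed[OF W] in \<open>auto simp: sub_dvs_carrier simp del: direct_sum_simps(1)\<close>, auto)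
  then show ?thesis by (simp only: sub_dvs_carrier V W E)
qed


section \<open>The horseshoe construction\<close>

text \<open>By exactness \<open>q\<close> has values in the image of \<open>i\<close>, and as
  \<open>i\<close> is an induction, \<open>r\<close> with \<open>i \<circ> r = q\<close> is a plot
  of \<open>A'\<close>. It remains to lift \<open>r\<close> along \<open>e\<close>.\<close>

lemma short_exact_lift_kernel:
  assumes ex: "short_exact A' i A p A''" and sub: "subduction P A' e"
    and q: "plots A n U q" "\<And>u. u \<in> U \<Longrightarrow> p (q u) = \<zero>\<^bsub>A''\<^esub>" and u: "u \<in> U"
  shows "\<exists>U' t. openin (Euclidean_space n) U' \<and> u \<in> U' \<and> U' \<subseteq> U \<and> plots P n U' t \<and> (\<forall>v\<in>U'. q v = i (e (t v)))"
proof -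
  have A: "is_dvs A" and im: "i ` carrier A' = a_kernel A A'' p" and ind: "induction A' A i"
    using ex by (auto simp: short_exact_def)
  note D = is_dvs_diffeo[OF A]
  have qi: "q v \<in> i ` carrier A'" if "v \<in> U" for v
    unfolding im using q(2)[OF that] diffeo_in[OF D, OF q(1) that] by (simp add: a_kernel_def')
  define r where "r v = inv_into (carrier A') i (q v)" for v
  have r: "r v \<in> carrier A'" "i (r v) = q v" if "v \<in> U" for v
    using qi[OF that] by (simp_all add: r_def inv_into_into f_inv_into_f)
  have "plots A n U (i \<circ> r)" by (rule diffeo_cong[OF D, OF q(1)]) (simp add: r)
  then have "plots A' n U r"
    using ind r diffeo_open[OF D, OF q(1)] unfolding induction_map_def by blast
  from subductionE[OF sub, OF this u]
  obtain U' t where U': "openin (Euclidean_space n) U'" "u \<in> U'" "U' \<subseteq> U" and t: "plots P n U' t"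
    "\<And>v. v \<in> U' \<Longrightarrow> r v = e (t v)" by blast
  have "q v = i (e (t v))" if "v \<in> U'" for v using t(2)[OF that] r(2)[of v] U'(3) that by auto
  then show ?thesis using U' t(1) by blast
qed

text \<open>The last conclusion has the same form as the assumption \<open>ex\<close>, with the
  three kernels as terms; this is what makes the step repeatable.\<close>

lemma horseshoe_step:
  assumes ex: "short_exact A' i A p A''"
    and P': "is_dvs P'" and e': "e' \<in> dvs_hom P' A'" and sub': "subduction P' A' e'"
    and P'': "projective P''" and e'': "e'' \<in> dvs_hom P'' A''" and sub'': "subduction P'' A'' e''"
  obtains e where "e \<in> dvs_hom (P' \<oplus>\<^sub>D P'') A" "subduction (P' \<oplus>\<^sub>D P'') A e"
    "\<And>x. x \<in> carrier P' \<Longrightarrow> e (x, \<zero>\<^bsub>P''\<^esub>) = i (e' x)"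
    "\<And>y. y \<in> carrier (P' \<oplus>\<^sub>D P'') \<Longrightarrow> p (e y) = e'' (snd y)"
    "short_exact (sub_dvs P' (a_kernel P' A' e')) (\<lambda>x. (x, \<zero>\<^bsub>P''\<^esub>))
       (sub_dvs (P' \<oplus>\<^sub>D P'') (a_kernel (P' \<oplus>\<^sub>D P'') A e)) snd (sub_dvs P'' (a_kernel P'' A'' e''))"
proof -
  have A': "is_dvs A'" and A: "is_dvs A" and A'': "is_dvs A''" and i: "i \<in> dvs_hom A' A" and p: "p \<in> dvs_hom A A''"
    and inj: "inj_on i (carrier A')" and im: "i ` carrier A' = a_kernel A A'' p" and subp: "subduction A A'' p"
    using ex by (auto simp: short_exact_def)
  have dP'': "is_dvs P''" using P'' by (simp add: projective_def)
  note E = is_dvs_direct_sum[OF P' dP'']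
  note D' = is_dvs_diffeo[OF P'] and D'' = is_dvs_diffeo[OF dP''] and DA = is_dvs_diffeo[OF A]
  obtain h where h: "h \<in> dvs_hom P'' A" "\<And>y. y \<in> carrier P'' \<Longrightarrow> e'' y = p (h y)"
    using projective_lift[OF P'' A p subp e'' A''] by metis
  note hc = dvs_hom_in[OF h(1)]
  have ie: "(i \<circ> e') \<in> dvs_hom P' A" by (rule dvs_hom_comp[OF e' i])
  have iec: "i (e' x) \<in> carrier A" if "x \<in> carrier P'" for x using dvs_hom_in[OF ie that] by simp
  have pie: "p (i (e' x)) = \<zero>\<^bsub>A''\<^esub>" if "x \<in> carrier P'" for x
    using im dvs_hom_in[OF e' that] by (auto simp: a_kernel_def')
  \<comment> \<open>Injectivity of \<open>i\<close> is what makes \<open>(x, 0)\<close> lie in the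
    kernel of \<open>e\<close> only when \<open>x\<close> lies in the kernel of
    \<open>e'\<close>.\<close>
  have i_zero: "i x = \<zero>\<^bsub>A\<^esub> \<longleftrightarrow> x = \<zero>\<^bsub>A'\<^esub>" if "x \<in> carrier A'" for x
    using inj_on_eq_iff[OF inj that dvs_zero_closed[OF A']] dvs_hom_zero[OF A' A i] by simp
  define e where "e = (\<lambda>(x, y). (i \<circ> e') x \<oplus>\<^bsub>A\<^esub> h y)"
  have e: "e \<in> dvs_hom (P' \<oplus>\<^sub>D P'') A"
    unfolding e_def by (rule dvs_hom_copair[OF P' dP'' A ie h(1)])
  have e_inl: "e (x, \<zero>\<^bsub>P''\<^esub>) = i (e' x)" if "x \<in> carrier P'" for x
    using iec[OF that] by (simp add: e_def dvs_hom_zero[OF dP'' A h(1)] dvs_simps[OF A])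
  have pe: "p (e y) = e'' (snd y)" if "y \<in> carrier (P' \<oplus>\<^sub>D P'')" for y
    using that iec hc h(2) dvs_hom_in[OF p]
    by (auto simp: e_def dvs_hom_add[OF p] pie dvs_simps[OF A''])
  have sub: "subduction (P' \<oplus>\<^sub>D P'') A e"
  proof (rule subduction_dvsI[OF E A e])
    fix n U q and u :: "nat \<Rightarrow> real" assume q: "plots A n U q" and u: "u \<in> U"
    obtain U1 s where U1: "openin (Euclidean_space n) U1" "u \<in> U1" "U1 \<subseteq> U" and s: "plots P'' n U1 s"
      "\<And>v. v \<in> U1 \<Longrightarrow> p (q v) = e'' (s v)"
      by (rule subductionE[OF sub'', OF dvs_hom_plot[OF p q] u]) (rule that, assumption+)
    have q1: "plots A n U1 q" by (rule diffeo_restrict[OF DA, OF q U1(1,3)])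
    \<comment> \<open>The error of \<open>h \<circ> s\<close> as an approximation to
      \<open>q\<close>. Both have the same image under \<open>p\<close>, so the error comes from
      \<open>P'\<close> through \<open>i \<circ> e'\<close>.\<close>
    let ?r = "\<lambda>v. q v \<oplus>\<^bsub>A\<^esub> (- 1) \<odot>\<^bsub>A\<^esub> h (s v)"
    have r: "plots A n U1 ?r"
      by (intro dvs_plot_add[OF A q1] dvs_plot_smult_const[OF A] dvs_hom_plot[OF h(1) s(1)])
    have c: "q v \<in> carrier A" "h (s v) \<in> carrier A" "s v \<in> carrier P''" if "v \<in> U1" for v
      using diffeo_in[OF DA, OF q1 that] diffeo_in[OF D'', OF s(1) that] hc by auto
    have "p (?r v) = \<zero>\<^bsub>A''\<^esub>" if "v \<in> U1" for v
      using s(2)[OF that] c[OF that] h(2) by (simp add: dvs_hom_eq_iff_diff_in_kernel[OF A A'' p])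
    from short_exact_lift_kernel[OF ex sub' r this U1(2)]
    obtain U2 t where U2: "openin (Euclidean_space n) U2" "u \<in> U2" "U2 \<subseteq> U1" and t: "plots P' n U2 t"
      "\<forall>v\<in>U2. ?r v = i (e' (t v))" by blast
    have "plots (P' \<oplus>\<^sub>D P'') n U2 (\<lambda>v. (t v, s v))"
      using t(1) diffeo_restrict[OF D'', OF s(1) U2(1,3)] by (simp add: prod_diffeology_def o_def)
    moreover have "q v = e (t v, s v)" if v: "v \<in> U2" for v
    proof -
      have "i (e' (t v)) = ?r v" using t(2) v by simp
      then show ?thesis
        using dvs_diff_add_cancel[OF A] c[of v] v U2 by (simp add: e_def subset_iff)
    qed
    ultimately show "\<exists>U' r. openin (Euclidean_space n) U' \<and> u \<in> U' \<and> U' \<subseteq> U \<and> plots (P' \<oplus>\<^sub>D P'') n U' r \<and>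
        (\<forall>v\<in>U'. q v = e (r v))"
      using U2 U1 by (intro exI[of _ U2] exI[of _ "\<lambda>v. (t v, s v)"]) auto
  qed
  have "short_exact (sub_dvs P' (a_kernel P' A' e')) (\<lambda>x. (x, \<zero>\<^bsub>P''\<^esub>))
       (sub_dvs (P' \<oplus>\<^sub>D P'') (a_kernel (P' \<oplus>\<^sub>D P'') A e)) snd (sub_dvs P'' (a_kernel P'' A'' e''))"
  proof (rule short_exact_direct_sum_sub[OF P' dP''])
    fix x assume "x \<in> carrier P'"
    then show "(x, \<zero>\<^bsub>P''\<^esub>) \<in> a_kernel (P' \<oplus>\<^sub>D P'') A e \<longleftrightarrow> x \<in> a_kernel P' A' e'"
      using i_zero dvs_hom_in[OF e'] by (simp add: a_kernel_def' e_inl dvs_zero_closed[OF dP''])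
  next
    fix y assume "y \<in> a_kernel (P' \<oplus>\<^sub>D P'') A e"
    then show "snd y \<in> a_kernel P'' A'' e''"
      using pe[of y] dvs_hom_zero[OF A A'' p] by (auto simp: a_kernel_def')
  next
    fix n U q and u :: "nat \<Rightarrow> real"
    assume q: "plots P'' n U q" "q \<in> U \<rightarrow> a_kernel P'' A'' e''" and u: "u \<in> U"
    \<comment> \<open>The pair \<open>(t v, q v)\<close> is killed by \<open>e\<close> exactly when
      \<open>i (e' (t v))\<close> is the negative of \<open>h (q v)\<close>, hence the sign.\<close>
    let ?r = "\<lambda>v. (- 1) \<odot>\<^bsub>A\<^esub> h (q v)"
    have r: "plots A n U ?r" by (intro dvs_plot_smult_const[OF A] dvs_hom_plot[OF h(1) q(1)])
    have c: "q v \<in> carrier P''" "p (h (q v)) = \<zero>\<^bsub>A''\<^esub>" if "v \<in> U" for v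
      using q(2) that h(2) by (auto simp: a_kernel_def' Pi_iff)
    have "p (?r v) = \<zero>\<^bsub>A''\<^esub>" if "v \<in> U" for v
      using c[OF that] hc by (simp add: dvs_hom_smult[OF p] dvs_simps[OF A''])
    from short_exact_lift_kernel[OF ex sub' r this u]
    obtain U' t where U': "openin (Euclidean_space n) U'" "u \<in> U'" "U' \<subseteq> U" and t: "plots P' n U' t"
      "\<forall>v\<in>U'. ?r v = i (e' (t v))" by blast
    have "(t v, q v) \<in> a_kernel (P' \<oplus>\<^sub>D P'') A e" if v: "v \<in> U'" for v
    proof -
      have "i (e' (t v)) = ?r v" using t(2) v by simp
      then have "e (t v, q v) = \<zero>\<^bsub>A\<^esub>"
        using dvs_smult_minus_one[OF A hc] c v U' by (auto simp: e_def)
      then show ?thesis using diffeo_in[OF D', OF t(1) v] c v U' by (auto simp: a_kernel_def')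
    qed
    then show "\<exists>U' t. openin (Euclidean_space n) U' \<and> u \<in> U' \<and> U' \<subseteq> U \<and> plots P' n U' t \<and>
        (\<forall>v\<in>U'. (t v, q v) \<in> a_kernel (P' \<oplus>\<^sub>D P'') A e)"
      using U' t by blast
  qed (use is_dvs_kernel[OF P' A' e'] is_dvs_kernel[OF E A e] is_dvs_kernel[OF dP'' A'' e''] in \<open>auto simp: a_kernel_def'\<close>)
  then show thesis using that e sub e_inl pe by blast
qed

section \<open>Iterating the step along the two resolutions\<close>

theorem lemma7p2:
  fixes A' :: "'a dvs" and A :: "'b dvs" and A'' :: "'c dvs"
    and P' :: "nat \<Rightarrow> 'p dvs" and P'' :: "nat \<Rightarrow> 'q dvs"
  assumes "short_exact A' i\<^sub>A A \<pi>\<^sub>A A''"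
    and "projective_resolution P' d' \<epsilon>' A'"
    and "projective_resolution P'' d'' \<epsilon>'' A''"
  shows "\<exists>d \<epsilon> i \<pi>.
    projective_resolution (\<lambda>n. P' n \<oplus>\<^sub>D P'' n) d \<epsilon> A \<and>
    (\<forall>n. short_exact (P' n) (i n) (P' n \<oplus>\<^sub>D P'' n) (\<pi> n) (P'' n)) \<and>
    (\<forall>x\<in>carrier (P' 0). \<epsilon> (i 0 x) = i\<^sub>A (\<epsilon>' x)) \<and>
    (\<forall>y\<in>carrier (P' 0 \<oplus>\<^sub>D P'' 0). \<pi>\<^sub>A (\<epsilon> y) = \<epsilon>'' (\<pi> 0 y)) \<and>
    (\<forall>n\<ge>1. \<forall>x\<in>carrier (P' n). d n (i n x) = i (n - 1) (d' n x)) \<and>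
    (\<forall>n\<ge>1. \<forall>y\<in>carrier (P' n \<oplus>\<^sub>D P'' n). \<pi> (n - 1) (d n y) = d'' n (\<pi> n y))"
proof -
  let ?P = "\<lambda>n. P' n \<oplus>\<^sub>D P'' n"
  let ?i = "\<lambda>n x. (x, \<zero>\<^bsub>P'' n\<^esub>)"
  define N' where "N' = resolution_kernel P' d' \<epsilon>' A'"
  define N'' where "N'' = resolution_kernel P'' d'' \<epsilon>'' A''"
  have A: "is_dvs A" using assms(1) by (simp add: short_exact_def)
  note R' = assms(2)[unfolded projective_resolution_iff, folded N'_def]
  note R'' = assms(3)[unfolded projective_resolution_iff, folded N''_def]
  have pr: "projective (P' n)" "projective (P'' n)" for n using R' R'' by blast+
  then have dvs: "is_dvs (P' n)" "is_dvs (P'' n)" "is_dvs (?P n)" for n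
    by (simp_all add: projective_def is_dvs_direct_sum)
  have \<epsilon>': "\<epsilon>' \<in> dvs_hom (P' 0) A'" "subduction (P' 0) A' \<epsilon>'"
    and \<epsilon>'': "\<epsilon>'' \<in> dvs_hom (P'' 0) A''" "subduction (P'' 0) A'' \<epsilon>''"
    using R' R'' by blast+
  \<comment> \<open>A differential that subducts onto a kernel is also a morphism into that kernel,
    the form in which \<open>horseshoe_step\<close> takes it.\<close>
  have hom_sub: "f \<in> dvs_hom V (sub_dvs W N)"
    if "is_dvs V" "f \<in> dvs_hom V W" "subduction V (sub_dvs W N) f" for f V W N
    using that subduction_surj[OF that(3)] unfolding dvs_hom_def subduction_map_def by simp
  have d': "d' (Suc n) \<in> dvs_hom (P' (Suc n)) (sub_dvs (P' n) (N' n))"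
    "subduction (P' (Suc n)) (sub_dvs (P' n) (N' n)) (d' (Suc n))" for n
    using R' hom_sub[OF dvs(1)] by blast+
  have d'': "d'' (Suc n) \<in> dvs_hom (P'' (Suc n)) (sub_dvs (P'' n) (N'' n))"
    "subduction (P'' (Suc n)) (sub_dvs (P'' n) (N'' n)) (d'' (Suc n))" for n
    using R'' hom_sub[OF dvs(2)] by blast+
  \<comment> \<open>The invariant of the recursion, with \<open>N\<close> standing for the kernel of
    the map leaving degree \<open>n\<close>. Kernels are carried along instead of maps because the
    augmentation and the differentials have different types.\<close>
  define good where "good n N \<longleftrightarrow> N \<subseteq> carrier (?P n) \<and>
    short_exact (sub_dvs (P' n) (N' n)) (?i n) (sub_dvs (?P n) N) snd (sub_dvs (P'' n) (N'' n))" for n N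
  obtain \<epsilon> where \<epsilon>: "\<epsilon> \<in> dvs_hom (?P 0) A" "subduction (?P 0) A \<epsilon>"
    "\<And>x. x \<in> carrier (P' 0) \<Longrightarrow> \<epsilon> (?i 0 x) = i\<^sub>A (\<epsilon>' x)"
    "\<And>y. y \<in> carrier (?P 0) \<Longrightarrow> \<pi>\<^sub>A (\<epsilon> y) = \<epsilon>'' (snd y)"
    and good0: "good 0 (a_kernel (?P 0) A \<epsilon>)"
    using horseshoe_step[OF assms(1) dvs(1) \<epsilon>' pr(2) \<epsilon>'']
    by (auto simp: good_def N'_def N''_def a_kernel_def')
  \<comment> \<open>One turn of the recursion: some differential \<open>e\<close> subducts onto the
    old kernel \<open>N\<close> compatibly with both resolutions, and \<open>M\<close> is its
    kernel.\<close>
  define next_kernel where "next_kernel n N M \<longleftrightarrow> (\<exists>e. e \<in> dvs_hom (?P (Suc n)) (?P n) \<and>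
    subduction (?P (Suc n)) (sub_dvs (?P n) N) e \<and>
    (\<forall>x\<in>carrier (P' (Suc n)). e (?i (Suc n) x) = ?i n (d' (Suc n) x)) \<and>
    (\<forall>y\<in>carrier (?P (Suc n)). snd (e y) = d'' (Suc n) (snd y)) \<and>
    M = a_kernel (?P (Suc n)) (?P n) e)" for n N M
  have step: "\<exists>M. good (Suc n) M \<and> next_kernel n N M" if "good n N" for n N
  proof -
    have N: "N \<subseteq> carrier (?P n)"
      and ex: "short_exact (sub_dvs (P' n) (N' n)) (?i n) (sub_dvs (?P n) N) snd (sub_dvs (P'' n) (N'' n))"
      using that by (auto simp: good_def)
    obtain e where e: "e \<in> dvs_hom (?P (Suc n)) (sub_dvs (?P n) N)" "subduction (?P (Suc n)) (sub_dvs (?P n) N) e"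
      "\<And>x. x \<in> carrier (P' (Suc n)) \<Longrightarrow> e (?i (Suc n) x) = ?i n (d' (Suc n) x)"
      "\<And>y. y \<in> carrier (?P (Suc n)) \<Longrightarrow> snd (e y) = d'' (Suc n) (snd y)"
      and s: "short_exact (sub_dvs (P' (Suc n)) (N' (Suc n))) (?i (Suc n))
         (sub_dvs (?P (Suc n)) (a_kernel (?P (Suc n)) (?P n) e)) snd (sub_dvs (P'' (Suc n)) (N'' (Suc n)))"
      using horseshoe_step[OF ex dvs(1) d' pr(2) d''] unfolding N'_def N''_def resolution_kernel_simps a_kernel_sub_dvs
      by metis
    have "e \<in> dvs_hom (?P (Suc n)) (?P n)"
      using e(1) dvs_hom_into_sub_dvs[OF dvs(3) N] by blast
    moreover have "good (Suc n) (a_kernel (?P (Suc n)) (?P n) e)"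
      using s by (auto simp: good_def a_kernel_def')
    ultimately show ?thesis using e(2-4) unfolding next_kernel_def by blast
  qed
  \<comment> \<open>Dependent choice selects all kernels at once; the clause for
    \<open>n = 0\<close> ties the start to the chosen augmentation.\<close>
  have "\<exists>N. \<forall>n. (good n (N n) \<and> (n = 0 \<longrightarrow> N n = a_kernel (?P 0) A \<epsilon>)) \<and> next_kernel n (N n) (N (Suc n))"
    by (rule dependent_nat_choice) (use good0 step in auto)
  then obtain N where N0: "N 0 = a_kernel (?P 0) A \<epsilon>" and "\<And>n. next_kernel n (N n) (N (Suc n))" by blast
  then obtain e where e: "\<And>n. e n \<in> dvs_hom (?P (Suc n)) (?P n)"
    "\<And>n. subduction (?P (Suc n)) (sub_dvs (?P n) (N n)) (e n)"
    "\<And>n x. x \<in> carrier (P' (Suc n)) \<Longrightarrow> e n (?i (Suc n) x) = ?i n (d' (Suc n) x)"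
    "\<And>n y. y \<in> carrier (?P (Suc n)) \<Longrightarrow> snd (e n y) = d'' (Suc n) (snd y)"
    "\<And>n. N (Suc n) = a_kernel (?P (Suc n)) (?P n) (e n)"
    unfolding next_kernel_def by metis
  \<comment> \<open>The map \<open>e n\<close> leaves degree \<open>Suc n\<close>, hence the shift;
    truncated subtraction gives \<open>d 0\<close> the default value \<open>e 0\<close>.\<close>
  define d where "d n = e (n - 1)" for n
  have dSuc: "d (Suc n) = e n" for n by (simp add: d_def)
  \<comment> \<open>The selected sets are the actual kernels of the constructed maps, so the
    criterion \<open>projective_resolution_iff\<close> applies.\<close>
  have "N n = resolution_kernel ?P d \<epsilon> A n" for n
    by (cases n) (simp_all add: N0 e(5) dSuc)
  then have "projective_resolution ?P d \<epsilon> A"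
    unfolding projective_resolution_iff dSuc
    using A pr projective_direct_sum \<epsilon>(1,2) e(1,2) by metis
  moreover have "\<forall>n\<ge>1. \<forall>x\<in>carrier (P' n). d n (?i n x) = ?i (n - 1) (d' n x)"
    using e(3) by (metis Suc_diff_1 dSuc less_eq_Suc_le One_nat_def)
  moreover have "\<forall>n\<ge>1. \<forall>y\<in>carrier (?P n). snd (d n y) = d'' n (snd y)"
    using e(4) by (metis Suc_diff_1 dSuc less_eq_Suc_le One_nat_def)
  ultimately show ?thesis
    using short_exact_direct_sum[OF dvs(1,2)] \<epsilon>(3,4)
    by (intro exI[of _ d] exI[of _ \<epsilon>] exI[of _ ?i] exI[of _ "\<lambda>_. snd"]) blast
qed

end
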